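(* Let $\{\mathcal{F}_\lambda:\lambda\in\Lambda\}$ be a collection of nested closed convex parameter spaces and $T$ a linear functional. Suppose that for some constants $0<c_1\le c_2<\infty$ and $\varepsilon_0>0$ the following hold: (C1) $\Lambda$ is an ordered set with $\min(\Lambda)=\lambda_*\in\Lambda$, $\max(\Lambda)=\lambda^*\in\Lambda$, and $\mathcal{F}_{\lambda_1}\subset\mathcal{F}_{\lambda_2}$ if $\lambda_1>\lambda_2$. (C2) For all $0<\varepsilon\le\varepsilon_0$ and all $\lambda\in\Lambda$, $c_1\varepsilon^{r_\lambda}\le\omega(\varepsilon,\mathcal{F}_\lambda)\le c_2\varepsilon^{r_\lambda}$, where $0<r_{\lambda_2}<r_{\lambda_1}\le1$ if $\lambda_2<\lambda_1$. (C3) For $\lambda_2<\lambda_1$ and all $0<\varepsilon\le\varepsilon_0$, $\omega(\varepsilon,\mathcal{F}_{\lambda_1})<\omega(\varepsilon,\mathcal{F}_{\lambda_2})$ and $\omega_+(\varepsilon,\mathcal{F}_{\lambda_1},\mathcal{F}_{\lambda_2})\ge c_1\omega(\varepsilon,\mathcal{F}_{\lambda_2})$. (C4) For any fixed $0<\varepsilon\le\varepsilon_0$ the set $\{\omega(\varepsilon,\mathcal{F}_\lambda):\lambda\in\Lambda\}$ is compact. Then for the estimator $\hat T^*$ constructed in the context there exists a constant $C>0$ such that (for all sufficiently large $n$) $$\sup_{f\in\mathcal{F}_{\lambda^*}}E(\hat T^*-Tf)^2\le C\,\omega^2\!\left(\tfrac1{\sqrt n},\mathcal{F}_{\lambda^*}\right),$$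 and for all $\lambda\in\Lambda$ with $\lambda<\lambda^*$ $$\sup_{f\in\mathcal{F}_\lambda}E(\hat T^*-Tf)^2\le C\,\omega^2\!\left(\sqrt{\tfrac{\log n}n},\mathcal{F}_\lambda\right).$$
   Context: White noise model: one observes $dY(t)=f(t)\,dt+\frac{1}{\sqrt n}\,dW(t)$, $-\frac12\le t\le\frac12$, where $W$ is a standard Brownian motion and $f\in L^2[-\frac12,\frac12]$ is unknown. Expectations and probabilities are taken under the true $f$. Parameter spaces are subsets of $L^2[-\frac12,\frac12]$; $T$ is a linear functional (not necessarily $L^2$-continuous) defined on the functions considered. A linear estimator is one of the form $a+\int k(t)\,dY(t)$ with $a\in\mathbb{R}$, $k\in L^2$ (a constant term is allowed). $\log$ is the natural logarithm. Moduli: $\omega(\varepsilon,\mathcal{F},\mathcal{H})=\sup\{Tg-Tf:\|g-f\|_2\le\varepsilon,\ f\in\mathcal{F},\ g\in\mathcal{H}\}$; $\omega_+(\varepsilon,\mathcal{F},\mathcal{H})=\sup\{|Tg-Tf|:\|g-f\|_2\le\varepsilon,\ f\in\mathcal{F},\ g\in\mathcal{H}\}$; $\omega(\varepsilon,\mathcal{F})=\omega(\varepsilon,\mathcal{F},\mathcal{F})$. Grid (for $n$ large enough that $\sqrt{\log n/n}\le\varepsilon_0$). Let $\Omega_n=\{\omega(\sqrt{\log n/n},\mathcal{F}_\lambda):\lambda\in\Lambda\}$, a compact set of positive numbers. If every $\omega\in\Omega_n$ with $\omega>\min(\Omega_n)$ satisfies $\omega>\frac12\max(\Omega_n)$, set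 $k_n=2$, $\xi_1=\min(\Omega_n)$, $\xi_2=\max(\Omega_n)$. Otherwise let $\xi_1<\dots<\xi_{k_n}$ be the unique finite sequence in $\Omega_n$ with $\xi_1=\min(\Omega_n)$, $\xi_{k_n}=\max(\Omega_n)$, $\xi_{i+1}\ge2\xi_i$ for $2\le i\le k_n-1$, and such that every $\omega\in\Omega_n$ satisfies $\frac12\xi_i<\omega\le\xi_i$ for some $i$. Let $\lambda_i\in\Lambda$ be such that $\xi_i=\omega(\sqrt{\log n/n},\mathcal{F}_{\lambda_i})$, and write $\mathcal{F}_i=\mathcal{F}_{\lambda_i}$; so $\mathcal{F}_1\subset\dots\subset\mathcal{F}_{k_n}$, $\lambda_1=\lambda^*$, $\lambda_{k_n}=\lambda_*$. Construction of $\hat T^*$. $\hat T_1$ is a linear estimator with $\sup_{f\in\mathcal{F}_1}E(\hat T_1-Tf)^2\le\omega^2(\frac1{\sqrt n},\mathcal{F}_1)$. For $1\le i,j\le k_n$ with $\max(i,j)\ge2$, $\hat T_{i,j}$ is a linear estimator such that, with $V=\frac1{\log n}\omega^2\left(\sqrt{\frac{\log n}n},\mathcal{F}_i,\mathcal{F}_j\right)$, $\mathrm{Var}(\hat T_{i,j})\le V$, $\sup_{f\in\mathcal{F}_i}(E\hat T_{i,j}-Tf)\le\frac12\sup_{\varepsilon>0}(\omega(\varepsilon,\mathcal{F}_i,\mathcal{F}_j)-\sqrt{nV}\,\varepsilon)$, $\inf_{f\in\mathcal{F}_j}(E\hat T_{i,j}-Tf)\ge-\frac12\sup_{\varepsilon>0}(\omega(\varepsilon,\mathcal{F}_i,\mathcal{F}_j)-\sqrt{nV}\,\varepsilon)$.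 (Such estimators are known to exist.) For $j\ge2$ write $\hat T_j=\hat T_{j,j}$. For $i<j$ let $I_{i,j}$ be the indicator of the event $$\hat T_{i,j}-\tfrac{11}2\omega\left(\sqrt{\tfrac{\log n}n},\mathcal{F}_j\right)\le\hat T_i\le\hat T_{j,i}+\tfrac{11}2\omega\left(\sqrt{\tfrac{\log n}n},\mathcal{F}_j\right).$$ With $I_i=\prod_{j>i}I_{i,j}$ (empty products equal $1$, so $I_{k_n}=1$), the estimator uses $\hat T_i$ for the smallest $i$ with $I_i=1$: $$\hat T^*=\sum_{i=1}^{k_n}\Big(\prod_{m<i}(1-I_m)\Big)I_i\,\hat T_i.$$ *)

theory Defs
  imports "HOL-Probability.Probability"
begin

abbreviation unit_iv :: "real set" where
  "unit_iv \<equiv> {-1/2..1/2}"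

text \<open>
  Elements of \<open>L\<^sup>2\<close> are represented by functions; only the restriction to
  \<^term>\<open>unit_iv\<close> matters for the seminorm \<open>l2norm\<close>.
\<close>

definition L2 :: "(real \<Rightarrow> real) set" where
  "L2 = {f. f \<in> borel_measurable (lebesgue_on unit_iv) \<and>
            integrable (lebesgue_on unit_iv) (\<lambda>t. (f t)\<^sup>2)}"

definition l2norm :: "(real \<Rightarrow> real) \<Rightarrow> real" where
  "l2norm f = sqrt (LINT t|lebesgue_on unit_iv. (f t)\<^sup>2)"

definition convex_class :: "(real \<Rightarrow> real) set \<Rightarrow> bool" where
  "convex_class F \<longleftrightarrow>
     (\<forall>f\<in>F. \<forall>g\<in>F. \<forall>u\<in>{0..1}. (\<lambda>t. (1 - u) * f t + u * g t) \<in> F)"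

text \<open>
  A limit in \<open>L\<^sup>2\<close> is determined only up to null sets, so closedness asks for some
  representative of the limit to lie in the class. Thus a class may, but need not,
  be saturated under equality almost everywhere.
\<close>

definition closed_class :: "(real \<Rightarrow> real) set \<Rightarrow> bool" where
  "closed_class F \<longleftrightarrow>
     (\<forall>u g. (\<forall>m::nat. u m \<in> F) \<and> g \<in> L2 \<and>
            (\<lambda>m. l2norm (\<lambda>t. u m t - g t)) \<longlonglongrightarrow> 0
        \<longrightarrow> (\<exists>h\<in>F. l2norm (\<lambda>t. h t - g t) = 0))"

text \<open>No continuity of the functional is required, e.g. point evaluations are allowed.\<close>

definition linear_functional_on ::
    "(real \<Rightarrow> real) set \<Rightarrow> ((real \<Rightarrow> real) \<Rightarrow> real) \<Rightarrow> bool" where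
  "linear_functional_on D T \<longleftrightarrow>
     (\<forall>f\<in>D. \<forall>g\<in>D. \<forall>a b. (\<lambda>t. a * f t + b * g t) \<in> D \<and>
         T (\<lambda>t. a * f t + b * g t) = a * T f + b * T g)"

text \<open>
  The process starts at the left end point of the interval; only its increments enter
  the stochastic integrals below.
\<close>

definition brownian_motion :: "'w measure \<Rightarrow> (real \<Rightarrow> 'w \<Rightarrow> real) \<Rightarrow> bool" where
  "brownian_motion M W \<longleftrightarrow>
     prob_space M \<and>
     (\<forall>t\<in>unit_iv. W t \<in> borel_measurable M) \<and>
     (AE w in M. W (-1/2) w = 0) \<and>
     (\<forall>s\<in>unit_iv. \<forall>t\<in>unit_iv. s < t \<longrightarrow>
        distributed M lborel (\<lambda>w. W t w - W s w) (normal_density 0 (sqrt (t - s)))) \<and>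
     (\<forall>(m::nat) t. (\<forall>i\<le>m. t i \<in> unit_iv) \<and> (\<forall>i<m. t i < t (Suc i)) \<longrightarrow>
        prob_space.indep_vars M (\<lambda>_. borel) (\<lambda>i w. W (t (Suc i)) w - W (t i) w) {..<m}) \<and>
     (AE w in M. continuous_on unit_iv (\<lambda>t. W t w))"

definition obs ::
    "(real \<Rightarrow> 'w \<Rightarrow> real) \<Rightarrow> nat \<Rightarrow> (real \<Rightarrow> real) \<Rightarrow> real \<Rightarrow> 'w \<Rightarrow> real" where
  "obs W n f t w = (LINT s:{-1/2..t}|lebesgue. f s) + W t w / sqrt (real n)"

text \<open>
  A list of triples \<open>(c, s, t)\<close> encodes the step function that is the sum of the
  \<open>c * indicator {s<..t}\<close>.
\<close>

definition valid_step :: "(real \<times> real \<times> real) list \<Rightarrow> bool" where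
  "valid_step p \<longleftrightarrow> (\<forall>(c, s, t)\<in>set p. -1/2 \<le> s \<and> s \<le> t \<and> t \<le> 1/2)"

definition step_fun :: "(real \<times> real \<times> real) list \<Rightarrow> real \<Rightarrow> real" where
  "step_fun p x = (\<Sum>(c, s, t)\<leftarrow>p. c * indicator {s<..t} x)"

definition step_integral ::
    "(real \<times> real \<times> real) list \<Rightarrow> (real \<Rightarrow> 'w \<Rightarrow> real) \<Rightarrow> 'w \<Rightarrow> real" where
  "step_integral p X w = (\<Sum>(c, s, t)\<leftarrow>p. c * (X t w - X s w))"

text \<open>
  \<open>has_stoch_integral M X k Z\<close>: the random variable \<open>Z\<close> is a version of the
  integral of the deterministic function \<open>k\<close> against \<open>dX\<close>, i.e. the mean-square
  limit of the integrals of step functions that approximate \<open>k\<close>. For the processes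
  \<open>obs W n f\<close> this determines \<open>Z\<close> up to null sets.
\<close>

definition has_stoch_integral ::
    "'w measure \<Rightarrow> (real \<Rightarrow> 'w \<Rightarrow> real) \<Rightarrow> (real \<Rightarrow> real) \<Rightarrow> ('w \<Rightarrow> real) \<Rightarrow> bool" where
  "has_stoch_integral M X k Z \<longleftrightarrow>
     k \<in> L2 \<and> Z \<in> borel_measurable M \<and>
     (\<exists>p. (\<forall>m::nat. valid_step (p m)) \<and>
          (\<lambda>m. l2norm (\<lambda>t. step_fun (p m) t - k t)) \<longlonglongrightarrow> 0 \<and>
          (\<lambda>m. \<integral>\<^sup>+ w. ennreal ((step_integral (p m) X w - Z w)\<^sup>2) \<partial>M) \<longlonglongrightarrow> 0)"

text \<open>
  An estimator \<open>S\<close> is given through the random variables \<open>S f\<close> that it yields when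
  the true function is \<open>f\<close>. It is linear if, with \<open>a\<close> and \<open>k\<close> not depending
  on \<open>f\<close>, it equals \<open>a\<close> plus the integral of \<open>k\<close> against \<open>d(obs W n f)\<close>.
\<close>

type_synonym 'w estimator = "(real \<Rightarrow> real) \<Rightarrow> 'w \<Rightarrow> real"

definition linear_estimator ::
    "'w measure \<Rightarrow> (real \<Rightarrow> 'w \<Rightarrow> real) \<Rightarrow> nat \<Rightarrow> 'w estimator \<Rightarrow> bool" where
  "linear_estimator M W n S \<longleftrightarrow>
     (\<exists>a. \<exists>k\<in>L2. \<forall>f\<in>L2. has_stoch_integral M (obs W n f) k (\<lambda>w. S f w - a))"

definition sup_risk ::
    "'w measure \<Rightarrow> ((real \<Rightarrow> real) \<Rightarrow> real) \<Rightarrow> (real \<Rightarrow> real) set \<Rightarrow> 'w estimator \<Rightarrow> ennreal" where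
  "sup_risk M T F S = (SUP f\<in>F. \<integral>\<^sup>+ w. ennreal ((S f w - T f)\<^sup>2) \<partial>M)"

abbreviation bias ::
    "'w measure \<Rightarrow> ((real \<Rightarrow> real) \<Rightarrow> real) \<Rightarrow> 'w estimator \<Rightarrow> (real \<Rightarrow> real) \<Rightarrow> real" where
  "bias M T S f \<equiv> prob_space.expectation M (S f) - T f"

text \<open>Extended-real valued, so that an unbounded supremum is not assigned a spurious value.\<close>

definition modulus ::
    "((real \<Rightarrow> real) \<Rightarrow> real) \<Rightarrow> real \<Rightarrow> (real \<Rightarrow> real) set \<Rightarrow> (real \<Rightarrow> real) set \<Rightarrow> ereal" where
  "modulus T \<epsilon> F H =
     Sup {ereal (T g - T f) | f g. l2norm (\<lambda>t. g t - f t) \<le> \<epsilon> \<and> f \<in> F \<and> g \<in> H}"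

definition modulus_plus ::
    "((real \<Rightarrow> real) \<Rightarrow> real) \<Rightarrow> real \<Rightarrow> (real \<Rightarrow> real) set \<Rightarrow> (real \<Rightarrow> real) set \<Rightarrow> ereal" where
  "modulus_plus T \<epsilon> F H =
     Sup {ereal \<bar>T g - T f\<bar> | f g. l2norm (\<lambda>t. g t - f t) \<le> \<epsilon> \<and> f \<in> F \<and> g \<in> H}"

text \<open>Only used at arguments where the modulus is finite.\<close>

definition rmodulus ::
    "((real \<Rightarrow> real) \<Rightarrow> real) \<Rightarrow> real \<Rightarrow> (real \<Rightarrow> real) set \<Rightarrow> (real \<Rightarrow> real) set \<Rightarrow> real" where
  "rmodulus T \<epsilon> F H = real_of_ereal (modulus T \<epsilon> F H)"

definition logrt :: "nat \<Rightarrow> real" where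
  "logrt n = sqrt (ln (real n) / real n)"

text \<open>
  \<open>grid \<Omega> k \<xi>\<close>: the finite sequence selected from \<open>\<Omega>\<close> is \<open>\<xi> 1, \<dots>, \<xi> k\<close>.
  For the nonempty compact \<open>\<Omega>\<close> considered, \<open>Inf\<close> and \<open>Sup\<close> are minimum and maximum.
\<close>

definition grid :: "real set \<Rightarrow> nat \<Rightarrow> (nat \<Rightarrow> real) \<Rightarrow> bool" where
  "grid \<Omega> k \<xi> \<longleftrightarrow>
     (if \<forall>\<omega>\<in>\<Omega>. \<omega> > Inf \<Omega> \<longrightarrow> \<omega> > Sup \<Omega> / 2
      then k = 2 \<and> \<xi> 1 = Inf \<Omega> \<and> \<xi> 2 = Sup \<Omega>
      else k \<ge> 1 \<and> (\<forall>i\<in>{1..k}. \<xi> i \<in> \<Omega>) \<and>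
           (\<forall>i\<in>{1..<k}. \<xi> i < \<xi> (i + 1)) \<and>
           \<xi> 1 = Inf \<Omega> \<and> \<xi> k = Sup \<Omega> \<and>
           (\<forall>i. 2 \<le> i \<and> i + 1 \<le> k \<longrightarrow> \<xi> (i + 1) \<ge> 2 * \<xi> i) \<and>
           (\<forall>\<omega>\<in>\<Omega>. \<exists>i\<in>{1..k}. \<xi> i / 2 < \<omega> \<and> \<omega> \<le> \<xi> i))"

definition bias_bound ::
    "((real \<Rightarrow> real) \<Rightarrow> real) \<Rightarrow> nat \<Rightarrow> (real \<Rightarrow> real) set \<Rightarrow> (real \<Rightarrow> real) set \<Rightarrow> real \<Rightarrow> ereal" where
  "bias_bound T n F H V =
     ereal (1/2) * (SUP \<epsilon>\<in>{0<..}. modulus T \<epsilon> F H - ereal (sqrt (real n * V) * \<epsilon>))"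

text \<open>
  The requirements on the estimators for the pair of classes \<open>F\<close>, \<open>H\<close>. The variance of a
  linear estimator does not depend on the true function.
\<close>

definition pair_estimator ::
    "'w measure \<Rightarrow> (real \<Rightarrow> 'w \<Rightarrow> real) \<Rightarrow> nat \<Rightarrow> ((real \<Rightarrow> real) \<Rightarrow> real) \<Rightarrow>
     (real \<Rightarrow> real) set \<Rightarrow> (real \<Rightarrow> real) set \<Rightarrow> 'w estimator \<Rightarrow> bool" where
  "pair_estimator M W n T F H S \<longleftrightarrow>
     linear_estimator M W n S \<and>
     (let V = (rmodulus T (logrt n) F H)\<^sup>2 / ln (real n) in
        (\<forall>f\<in>L2. prob_space.variance M (S f) \<le> V) \<and>
        (SUP f\<in>F. ereal (bias M T S f)) \<le> bias_bound T n F H V \<and>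
        (INF f\<in>H. ereal (bias M T S f)) \<ge> - bias_bound T n F H V)"

definition base_estimator ::
    "'w measure \<Rightarrow> (real \<Rightarrow> 'w \<Rightarrow> real) \<Rightarrow> nat \<Rightarrow> ((real \<Rightarrow> real) \<Rightarrow> real) \<Rightarrow>
     (real \<Rightarrow> real) set \<Rightarrow> 'w estimator \<Rightarrow> bool" where
  "base_estimator M W n T F S \<longleftrightarrow>
     linear_estimator M W n S \<and>
     sup_risk M T F S \<le> ennreal ((rmodulus T (1 / sqrt (real n)) F F)\<^sup>2)"

text \<open>
  Below, \<open>G i\<close> is the \<open>i\<close>-th class on the grid, \<open>S1\<close> is the first base
  estimator and \<open>S i j\<close> are the pair estimators; \<open>S 1 1\<close> is never used.
\<close>

definition single_est :: "'w estimator \<Rightarrow> (nat \<Rightarrow> nat \<Rightarrow> 'w estimator) \<Rightarrow> nat \<Rightarrow> 'w estimator" where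
  "single_est S1 S i = (if i = 1 then S1 else S i i)"

definition pair_test ::
    "((real \<Rightarrow> real) \<Rightarrow> real) \<Rightarrow> nat \<Rightarrow> (nat \<Rightarrow> (real \<Rightarrow> real) set) \<Rightarrow>
     'w estimator \<Rightarrow> (nat \<Rightarrow> nat \<Rightarrow> 'w estimator) \<Rightarrow> nat \<Rightarrow> nat \<Rightarrow> 'w estimator" where
  "pair_test T n G S1 S i j f w =
     of_bool (S i j f w - 11/2 * rmodulus T (logrt n) (G j) (G j) \<le> single_est S1 S i f w \<and>
              single_est S1 S i f w \<le> S j i f w + 11/2 * rmodulus T (logrt n) (G j) (G j))"

definition accept ::
    "((real \<Rightarrow> real) \<Rightarrow> real) \<Rightarrow> nat \<Rightarrow> (nat \<Rightarrow> (real \<Rightarrow> real) set) \<Rightarrow> nat \<Rightarrow>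
     'w estimator \<Rightarrow> (nat \<Rightarrow> nat \<Rightarrow> 'w estimator) \<Rightarrow> nat \<Rightarrow> 'w estimator" where
  "accept T n G k S1 S i f w = (\<Prod>j\<in>{i<..k}. pair_test T n G S1 S i j f w)"

definition adaptive_estimator ::
    "((real \<Rightarrow> real) \<Rightarrow> real) \<Rightarrow> nat \<Rightarrow> (nat \<Rightarrow> (real \<Rightarrow> real) set) \<Rightarrow> nat \<Rightarrow>
     'w estimator \<Rightarrow> (nat \<Rightarrow> nat \<Rightarrow> 'w estimator) \<Rightarrow> 'w estimator" where
  "adaptive_estimator T n G k S1 S f w =
     (\<Sum>i\<in>{1..k}. (\<Prod>m\<in>{1..<i}. 1 - accept T n G k S1 S m f w) *
                   accept T n G k S1 S i f w * single_est S1 S i f w)"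

definition construction ::
    "'w measure \<Rightarrow> (real \<Rightarrow> 'w \<Rightarrow> real) \<Rightarrow> nat \<Rightarrow> ((real \<Rightarrow> real) \<Rightarrow> real) \<Rightarrow>
     'l set \<Rightarrow> ('l \<Rightarrow> (real \<Rightarrow> real) set) \<Rightarrow> nat \<Rightarrow> (nat \<Rightarrow> real) \<Rightarrow> (nat \<Rightarrow> 'l) \<Rightarrow>
     'w estimator \<Rightarrow> (nat \<Rightarrow> nat \<Rightarrow> 'w estimator) \<Rightarrow> bool" where
  "construction M W n T \<Lambda> F k \<xi> l S1 S \<longleftrightarrow>
     grid ((\<lambda>a. rmodulus T (logrt n) (F a) (F a)) ` \<Lambda>) k \<xi> \<and>
     (\<forall>i\<in>{1..k}. l i \<in> \<Lambda> \<and> \<xi> i = rmodulus T (logrt n) (F (l i)) (F (l i))) \<and>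
     base_estimator M W n T (F (l 1)) S1 \<and>
     (\<forall>i\<in>{1..k}. \<forall>j\<in>{1..k}. max i j \<ge> 2 \<longrightarrow>
        pair_estimator M W n T (F (l i)) (F (l j)) (S i j))"

end

theory Submission
  imports Defs
begin

text \<open>
  Integrals of deterministic step functions against the observed process are constant or normal;
  passing to the mean-square limit (almost sure convergence along a subsequence and Fatou's lemma),
  every linear estimator is sub-Gaussian around its mean, with its variance as proxy. Because the
  classes are convex and nested, \<open>\<omega>(\<epsilon>) / \<epsilon>\<close> is nonincreasing, so the bias bounds
  of the pair estimators are at most half the modulus at \<open>sqrt (log n / n)\<close>.

  Let \<open>f\<close> lie in the \<open>i\<close>-th grid class and let the estimator with index \<open>j\<close> be selected.
  If \<open>j < i\<close>, the passed test of \<open>j\<close> against \<open>i\<close> pins the estimator to \<open>T f\<close> up to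
  \<open>6 * \<omega> i\<close> and two centred errors of variance at most \<open>(\<omega> i)\<^sup>2 / log n\<close>; there are only
  \<open>O(log n)\<close> grid points, so the sum of their squares is harmless. If \<open>j > i\<close>, then
  \<open>j - 1 \<ge> i\<close> failed a test although \<open>f\<close> lies in its class. This forces a deviation of
  probability \<open>n powr (- 5/2)\<close>, against a risk inflated at most by the factor \<open>O(n)\<close>;
  Cauchy-Schwarz with fourth moments concludes. Only for \<open>j = 2\<close> and \<open>i = 1\<close> the deviation
  may come from the first estimator, whose error has fourth moment of order \<open>\<tau>^4\<close> with
  \<open>\<tau> = \<omega>(1 / sqrt n)\<close>; Markov's inequality turns the contribution into
  \<open>\<tau>\<^sup>2 * (\<omega> 2 / \<omega> m)\<^sup>2\<close>, which is summable since the grid grows geometrically.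
\<close>

section \<open>Linear estimators are sub-Gaussian\<close>

definition subgaussian :: "'w measure \<Rightarrow> ('w \<Rightarrow> real) \<Rightarrow> real \<Rightarrow> bool" where
  "subgaussian M Z v \<longleftrightarrow> Z \<in> borel_measurable M \<and>
     (\<forall>c. (\<integral>\<^sup>+ w. ennreal (exp (c * Z w)) \<partial>M) \<le> ennreal (exp (c\<^sup>2 * v / 2)))"

lemma subgaussianD:
  assumes "subgaussian M Z v"
  shows "Z \<in> borel_measurable M"
    and "(\<integral>\<^sup>+ w. ennreal (exp (c * Z w)) \<partial>M) \<le> ennreal (exp (c\<^sup>2 * v / 2))"
  using assms by (auto simp: subgaussian_def)

lemma subgaussian_mono:
  assumes "subgaussian M Z v" "v \<le> v'"
  shows "subgaussian M Z v'"
  unfolding subgaussian_def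
proof (intro conjI allI)
  show "Z \<in> borel_measurable M" using assms(1) by (rule subgaussianD)
  fix c
  have "(\<integral>\<^sup>+ w. ennreal (exp (c * Z w)) \<partial>M) \<le> ennreal (exp (c\<^sup>2 * v / 2))"
    using assms(1) by (rule subgaussianD)
  also have "\<dots> \<le> ennreal (exp (c\<^sup>2 * v' / 2))"
    using assms(2) by (intro ennreal_leI) (simp add: mult_left_mono)
  finally show "(\<integral>\<^sup>+ w. ennreal (exp (c * Z w)) \<partial>M) \<le> ennreal (exp (c\<^sup>2 * v' / 2))" .
qed

text \<open>Constants are a separate alternative because a normal law of variance zero has no
  density. They arise when no nonzero step coefficient remains.\<close>

definition gaussian_rv :: "'w measure \<Rightarrow> ('w \<Rightarrow> real) \<Rightarrow> bool" where
  "gaussian_rv M X \<longleftrightarrow> (\<exists>\<mu>. X = (\<lambda>_. \<mu>)) \<or>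
     (\<exists>\<mu> \<sigma>. 0 < \<sigma> \<and> distributed M lborel X (normal_density \<mu> \<sigma>))"

text \<open>Completing the square: tilting the density by \<open>exp (c * (x - \<mu>))\<close> gives
  a multiple of the normal density whose mean is shifted by \<open>c * \<sigma>\<^sup>2\<close>, and
  that density has mass one.\<close>

lemma (in prob_space) normal_mgf:
  assumes "0 < \<sigma>" and D: "distributed M lborel X (normal_density \<mu> \<sigma>)"
  shows "(\<integral>\<^sup>+ w. ennreal (exp (c * (X w - \<mu>))) \<partial>M) = ennreal (exp (c\<^sup>2 * \<sigma>\<^sup>2 / 2))"
proof -
  interpret N: prob_space "density lborel (normal_density (\<mu> + c * \<sigma>\<^sup>2) \<sigma>)"
    using assms(1) by (rule prob_space_normal_density)
  have one: "(\<integral>\<^sup>+ x. ennreal (normal_density (\<mu> + c * \<sigma>\<^sup>2) \<sigma> x) \<partial>lborel) = 1"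
    using N.emeasure_space_1 by (simp add: emeasure_density)
  have "(\<integral>\<^sup>+ w. ennreal (exp (c * (X w - \<mu>))) \<partial>M)
      = (\<integral>\<^sup>+ x. ennreal (normal_density \<mu> \<sigma> x) * ennreal (exp (c * (x - \<mu>))) \<partial>lborel)"
    by (rule distributed_nn_integral[OF D, symmetric]) measurable
  also have "\<dots> = (\<integral>\<^sup>+ x. ennreal (exp (c\<^sup>2 * \<sigma>\<^sup>2 / 2)) * ennreal (normal_density (\<mu> + c * \<sigma>\<^sup>2) \<sigma> x) \<partial>lborel)"
  proof (rule nn_integral_cong)
    fix x
    have e: "- (x - \<mu>)\<^sup>2 / (2 * \<sigma>\<^sup>2) + c * (x - \<mu>)
        = c\<^sup>2 * \<sigma>\<^sup>2 / 2 - (x - (\<mu> + c * \<sigma>\<^sup>2))\<^sup>2 / (2 * \<sigma>\<^sup>2)"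
      using assms(1) by (simp add: field_simps power2_eq_square)
    have "exp (- (x - \<mu>)\<^sup>2 / (2 * \<sigma>\<^sup>2)) * exp (c * (x - \<mu>))
        = exp (c\<^sup>2 * \<sigma>\<^sup>2 / 2) * exp (- (x - (\<mu> + c * \<sigma>\<^sup>2))\<^sup>2 / (2 * \<sigma>\<^sup>2))"
      unfolding exp_add[symmetric] e by simp
    then have "normal_density \<mu> \<sigma> x * exp (c * (x - \<mu>))
        = exp (c\<^sup>2 * \<sigma>\<^sup>2 / 2) * normal_density (\<mu> + c * \<sigma>\<^sup>2) \<sigma> x"
      unfolding normal_density_def by (simp add: mult.assoc mult.left_commute)
    then show "ennreal (normal_density \<mu> \<sigma> x) * ennreal (exp (c * (x - \<mu>)))
        = ennreal (exp (c\<^sup>2 * \<sigma>\<^sup>2 / 2)) * ennreal (normal_density (\<mu> + c * \<sigma>\<^sup>2) \<sigma> x)"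
      by (simp add: ennreal_mult[symmetric])
  qed
  also have "\<dots> = ennreal (exp (c\<^sup>2 * \<sigma>\<^sup>2 / 2))"
    by (simp add: nn_integral_cmult one)
  finally show ?thesis .
qed

lemma (in prob_space) gaussian_rv_subgaussian:
  assumes "gaussian_rv M X"
  shows "X \<in> borel_measurable M" "integrable M (\<lambda>w. (X w)\<^sup>2)"
    "subgaussian M (\<lambda>w. X w - expectation X) (variance X)"
proof -
  have "X \<in> borel_measurable M \<and> integrable M (\<lambda>w. (X w)\<^sup>2) \<and>
    subgaussian M (\<lambda>w. X w - expectation X) (variance X)"
    using assms unfolding gaussian_rv_def
  proof (elim disjE exE conjE)
    fix \<mu> assume "X = (\<lambda>_. \<mu>)"
    then show ?thesis by (simp add: subgaussian_def prob_space emeasure_space_1)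
  next
    fix \<mu> \<sigma> :: real
    assume s: "0 < \<sigma>" and D: "distributed M lborel X (normal_density \<mu> \<sigma>)"
    have m[measurable]: "X \<in> borel_measurable M" using distributed_measurable[OF D] by simp
    have E: "expectation X = \<mu>" and V: "variance X = \<sigma>\<^sup>2"
      using normal_distributed_expectation[OF s D] normal_distributed_variance[OF s D] by auto
    have 1: "integrable lborel (\<lambda>x. normal_density \<mu> \<sigma> x * (x - \<mu>)^k)" for k
      using s by (rule integrable_normal_moment)
    \<comment> \<open>The square of \<open>x\<close> is expanded in powers of
      \<open>x - \<mu>\<close>, so that one fact on central moments covers all three terms.\<close>
    have "integrable lborel (\<lambda>x. normal_density \<mu> \<sigma> x * (x - \<mu>)^2 + 2 * \<mu> * (normal_density \<mu> \<sigma> x * (x - \<mu>)^1) + \<mu>\<^sup>2 * (normal_density \<mu> \<sigma> x * (x - \<mu>)^0))"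
      by (intro Bochner_Integration.integrable_add integrable_mult_right 1)
    then have "integrable lborel (\<lambda>x. normal_density \<mu> \<sigma> x * x^2)"
      by (rule back_subst[of "integrable lborel"]) (auto simp: fun_eq_iff power2_eq_square algebra_simps)
    then have "integrable M (\<lambda>w. (X w)\<^sup>2)"
      using distributed_integrable[OF D, of "\<lambda>x. x\<^sup>2"] by simp
    moreover have "subgaussian M (\<lambda>w. X w - expectation X) (variance X)"
      unfolding subgaussian_def V unfolding E using normal_mgf[OF s D] by auto
    ultimately show ?thesis using m by blast
  qed
  then show "X \<in> borel_measurable M" "integrable M (\<lambda>w. (X w)\<^sup>2)"
    "subgaussian M (\<lambda>w. X w - expectation X) (variance X)" by auto
qed

section \<open>Step integrals of the observed process are Gaussian\<close>

lemma step_sum_refine: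
  fixes xs :: "real list"
  assumes "\<And>c s t. (c, s, t) \<in> set q \<Longrightarrow> s \<in> set xs \<and> t \<in> set xs \<and> s \<le> t"
    and "sorted xs" "distinct xs"
  shows "\<exists>a. \<forall>X :: real \<Rightarrow> real. (\<Sum>(c, s, t)\<leftarrow>q. c * (X t - X s))
      = (\<Sum>i<length xs - 1. a i * (X (xs ! Suc i) - X (xs ! i)))"
  using assms(1)
proof (induction q)
  case Nil
  show ?case by (rule exI[of _ "\<lambda>_. 0"]) simp
next
  case (Cons z q)
  obtain c s t where z: "z = (c, s, t)" by (cases z) auto
  obtain a where a: "\<forall>X :: real \<Rightarrow> real. (\<Sum>(c, s, t)\<leftarrow>q. c * (X t - X s))
      = (\<Sum>i<length xs - 1. a i * (X (xs ! Suc i) - X (xs ! i)))"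
    using Cons.IH Cons.prems unfolding list.set by blast
  have "s \<in> set xs" "t \<in> set xs" "s \<le> t" using Cons.prems z by auto
  then obtain i j where i: "i < length xs" "s = xs ! i" and j: "j < length xs" "t = xs ! j"
    by (metis in_set_conv_nth)
  have ij: "i \<le> j"
  proof (rule ccontr)
    assume "\<not> i \<le> j"
    then have "xs ! j < xs ! i"
      using assms(2,3) i(1) by (metis sorted_wrt_iff_nth_less strict_sorted_iff not_le)
    then show False using \<open>s \<le> t\<close> i j by simp
  qed
  \<comment> \<open>Telescoping over the list points between \<open>s\<close> and \<open>t\<close>.
    The new coefficients depend only on positions in the list, never on \<open>X\<close>, so one
    choice serves every sample path.\<close>
  have "c * (X t - X s) = (\<Sum>m<length xs - 1. (c * of_bool (m \<in> {i..<j})) * (X (xs ! Suc m) - X (xs ! m)))"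
    for X :: "real \<Rightarrow> real"
  proof -
    have "c * (X t - X s) = c * (\<Sum>m=i..<j. X (xs ! Suc m) - X (xs ! m))"
      using sum_Suc_diff'[OF ij, of "\<lambda>m. X (xs ! m)"] i j by simp
    also have "\<dots> = (\<Sum>m=i..<j. (c * of_bool (m \<in> {i..<j})) * (X (xs ! Suc m) - X (xs ! m)))"
      by (simp add: sum_distrib_left)
    also have "\<dots> = (\<Sum>m<length xs - 1. (c * of_bool (m \<in> {i..<j})) * (X (xs ! Suc m) - X (xs ! m)))"
      using j by (intro sum.mono_neutral_left) auto
    finally show ?thesis .
  qed
  then show ?case
    unfolding z using a
    by (intro exI[of _ "\<lambda>m. c * of_bool (m \<in> {i..<j}) + a m"]) (simp add: distrib_right sum.distrib)
qed

text \<open>Over a common partition the integral is a deterministic drift plus a weighted sum of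
  Brownian increments over disjoint intervals, which are independent normals.\<close>

lemma brownian_step_gaussian:
  assumes B: "brownian_motion M W" and p: "valid_step p" and n: "0 < n"
  shows "gaussian_rv M (\<lambda>w. step_integral p (obs W n f) w + a)"
proof -
  interpret prob_space M using B by (simp add: brownian_motion_def)
  \<comment> \<open>Inserting the left end point keeps the list of partition points nonempty even
    for empty \<open>p\<close>, so its length is a successor.\<close>
  define E where "E = insert (-1/2) ((\<lambda>(c, s, t). s) ` set p \<union> (\<lambda>(c, s, t). t) ` set p)"
  define xs where "xs = sorted_list_of_set E"
  have finE: "finite E" by (simp add: E_def)
  have E_iv: "E \<subseteq> unit_iv"
  proof -
    have "z \<in> unit_iv" if "(c, s, t) \<in> set p" "z = s \<or> z = t" for c s t z
      using p that unfolding valid_step_def by auto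
    then show ?thesis unfolding E_def by auto
  qed
  have xs: "set xs = E" "sorted xs" "distinct xs" using finE by (auto simp: xs_def)
  define m where "m = length xs - 1"
  have lenxs: "length xs = Suc m"
    using xs(1) by (cases xs) (auto simp: m_def E_def)
  have "\<exists>b. \<forall>X :: real \<Rightarrow> real. (\<Sum>(c, s, t)\<leftarrow>p. c * (X t - X s))
      = (\<Sum>i<length xs - 1. b i * (X (xs ! Suc i) - X (xs ! i)))"
  proof (rule step_sum_refine)
    fix c s t assume "(c, s, t) \<in> set p"
    then have "s \<in> (\<lambda>(c, s, t). s) ` set p" "t \<in> (\<lambda>(c, s, t). t) ` set p" "s \<le> t"
      using p by (auto simp: valid_step_def image_iff intro: bexI[of _ "(c, s, t)"])
    then show "s \<in> set xs \<and> t \<in> set xs \<and> s \<le> t"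
      unfolding xs(1) E_def by blast
  qed (use xs in auto)
  then obtain b where b: "\<And>X :: real \<Rightarrow> real. (\<Sum>(c, s, t)\<leftarrow>p. c * (X t - X s))
      = (\<Sum>i<m. b i * (X (xs ! Suc i) - X (xs ! i)))" by (auto simp: m_def)
  define \<Delta> where "\<Delta> i w = W (xs ! Suc i) w - W (xs ! i) w" for i w
  define A where "A t = (LINT s:{-1/2..t}|lebesgue. f s)" for t
  define d where "d = a + (\<Sum>i<m. b i * (A (xs ! Suc i) - A (xs ! i)))"
  \<comment> \<open>Zero coefficients are dropped: a normal variable scaled by zero has no density,
    and \<open>sum_indep_normal\<close> needs one for each summand.\<close>
  define I where "I = {i. i < m \<and> b i \<noteq> 0}"
  have eq: "step_integral p (obs W n f) w + a = d + (\<Sum>i\<in>I. b i / sqrt n * \<Delta> i w)" for w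
  proof -
    have "step_integral p (obs W n f) w
        = (\<Sum>i<m. b i * (obs W n f (xs ! Suc i) w - obs W n f (xs ! i) w))"
      using b[of "\<lambda>t. obs W n f t w"] by (simp add: step_integral_def)
    also have "\<dots> = (\<Sum>i<m. b i * (A (xs ! Suc i) - A (xs ! i)) + b i / sqrt n * \<Delta> i w)"
      by (intro sum.cong refl) (simp add: obs_def A_def \<Delta>_def diff_divide_distrib algebra_simps)
    also have "\<dots> = (\<Sum>i<m. b i * (A (xs ! Suc i) - A (xs ! i))) + (\<Sum>i<m. b i / sqrt n * \<Delta> i w)"
      by (rule sum.distrib)
    also have "(\<Sum>i<m. b i / sqrt n * \<Delta> i w) = (\<Sum>i\<in>I. b i / sqrt n * \<Delta> i w)"
      by (rule sum.mono_neutral_right) (auto simp: I_def)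
    finally show ?thesis by (simp add: d_def)
  qed
  have inc: "xs ! i < xs ! Suc i" if "i < m" for i
    using xs that lenxs by (metis Suc_less_eq lessI less_SucI sorted_wrt_iff_nth_less strict_sorted_iff)
  have iv: "xs ! i \<in> unit_iv" if "i \<le> m" for i
    using E_iv xs(1) lenxs that by (metis less_Suc_eq_le nth_mem subsetD)
  have indep: "indep_vars (\<lambda>_. borel) \<Delta> {..<m}"
  proof -
    have "\<forall>(m::nat) t. (\<forall>i\<le>m. t i \<in> unit_iv) \<and> (\<forall>i<m. t i < t (Suc i)) \<longrightarrow>
        indep_vars (\<lambda>_. borel) (\<lambda>i w. W (t (Suc i)) w - W (t i) w) {..<m}"
      using B unfolding brownian_motion_def by blast
    then have "indep_vars (\<lambda>_. borel) (\<lambda>i w. W (xs ! Suc i) w - W (xs ! i) w) {..<m}"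
      using inc iv by blast
    then show ?thesis by (simp add: \<Delta>_def[abs_def])
  qed
  have norm: "distributed M lborel (\<Delta> i) (normal_density 0 (sqrt (xs ! Suc i - xs ! i)))" if "i < m" for i
    using B inc[OF that] iv[of i] iv[of "Suc i"] that unfolding brownian_motion_def \<Delta>_def[abs_def]
    by auto
  show ?thesis
  proof (cases "I = {}")
    case True
    then show ?thesis unfolding gaussian_rv_def eq by auto
  next
    case False
    define \<sigma> where "\<sigma> i = \<bar>b i / sqrt n\<bar> * sqrt (xs ! Suc i - xs ! i)" for i
    have pos: "0 < \<sigma> i" if "i \<in> I" for i
      using that inc n by (auto simp: \<sigma>_def I_def)
    have "distributed M lborel (\<lambda>w. \<Sum>i\<in>I. b i / sqrt n * \<Delta> i w)
        (normal_density (\<Sum>i\<in>I. 0) (sqrt (\<Sum>i\<in>I. (\<sigma> i)\<^sup>2)))"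
    proof (rule sum_indep_normal)
      show "finite I" by (simp add: I_def)
      show "indep_vars (\<lambda>i. borel) (\<lambda>i w. b i / sqrt n * \<Delta> i w) I"
        by (rule indep_vars_compose2[OF indep_vars_subset[OF indep]]) (auto simp: I_def)
      show "distributed M lborel (\<lambda>w. b i / sqrt n * \<Delta> i w) (normal_density 0 (\<sigma> i))" if "i \<in> I" for i
      proof -
        have "i < m" "b i / sqrt n \<noteq> 0" "0 < sqrt (xs ! Suc i - xs ! i)"
          using that n inc by (auto simp: I_def)
        then show ?thesis using normal_density_affine[OF norm, of i "b i / sqrt n" 0]
          by (simp add: \<sigma>_def)
      qed
    qed (use False pos in auto)
    moreover have s: "0 < sqrt (\<Sum>i\<in>I. (\<sigma> i)\<^sup>2)"
    proof -
      have "finite I" by (simp add: I_def)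
      then have "0 < (\<Sum>i\<in>I. (\<sigma> i)\<^sup>2)"
        using False by (intro sum_pos zero_less_power pos)
      then show ?thesis by simp
    qed
    ultimately have "distributed M lborel (\<lambda>w. d + 1 * (\<Sum>i\<in>I. b i / sqrt n * \<Delta> i w))
        (normal_density (d + 1 * (\<Sum>i\<in>I. 0)) (\<bar>1\<bar> * sqrt (\<Sum>i\<in>I. (\<sigma> i)\<^sup>2)))"
      by (intro normal_density_affine) auto
    then show ?thesis unfolding gaussian_rv_def eq using s by auto
  qed
qed

section \<open>From step integrals to mean-square limits\<close>

lemma (in prob_space) integrable_square_add:
  fixes f g :: "'a \<Rightarrow> real"
  assumes [measurable]: "f \<in> borel_measurable M" "g \<in> borel_measurable M"
    and "integrable M (\<lambda>w. (f w)\<^sup>2)" "integrable M (\<lambda>w. (g w)\<^sup>2)"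
  shows "integrable M (\<lambda>w. (f w + g w)\<^sup>2)"
proof (rule Bochner_Integration.integrable_bound)
  show "integrable M (\<lambda>w. 2 * (f w)\<^sup>2 + 2 * (g w)\<^sup>2)" using assms by simp
  have "(x + y)\<^sup>2 \<le> 2 * x\<^sup>2 + 2 * y\<^sup>2" for x y :: real
    using sum_squares_bound[of x y] by (simp add: power2_sum)
  then show "AE w in M. norm ((f w + g w)\<^sup>2) \<le> norm (2 * (f w)\<^sup>2 + 2 * (g w)\<^sup>2)" by simp
qed measurable

lemma abs_mult_le_sum_squares: "\<bar>x * y\<bar> \<le> x\<^sup>2 + y\<^sup>2" for x y :: real
  using sum_squares_bound[of "\<bar>x\<bar>" "\<bar>y\<bar>"] mult_nonneg_nonneg[of "\<bar>x\<bar>" "\<bar>y\<bar>"]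
  unfolding abs_mult power2_abs by linarith

text \<open>Mean-square convergence also transports means and variances. The exponential bounds of
  the approximants therefore converge to the bound whose proxy is exactly the variance of
  \<open>Z\<close>, while Fatou's lemma handles the left-hand side.\<close>

lemma (in prob_space) subgaussian_limit:
  assumes u[measurable]: "\<And>m. u m \<in> borel_measurable M"
    and sq: "\<And>m. integrable M (\<lambda>w. (u m w)\<^sup>2)"
    and sg: "\<And>m. subgaussian M (\<lambda>w. u m w - expectation (u m)) (variance (u m))"
    and Z[measurable]: "Z \<in> borel_measurable M"
    and lim: "(\<lambda>m. \<integral>\<^sup>+ w. ennreal ((u m w - Z w)\<^sup>2) \<partial>M) \<longlonglongrightarrow> 0"
  shows "integrable M (\<lambda>w. (Z w)\<^sup>2)"
    "subgaussian M (\<lambda>w. Z w - expectation Z) (variance Z)"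
proof -
  \<comment> \<open>Convergence in \<open>ennreal\<close> leaves the early terms possibly infinite.
    Discarding those before \<open>N\<close> makes every difference square integrable.\<close>
  obtain N where N: "\<And>m. m \<ge> N \<Longrightarrow> (\<integral>\<^sup>+ w. ennreal ((u m w - Z w)\<^sup>2) \<partial>M) < 1"
    using order_tendstoD(2)[OF lim, of 1] by (auto simp: eventually_sequentially)
  define v where "v m = u (m + N)" for m
  define d where "d m w = v m w - Z w" for m w
  have [measurable]: "v m \<in> borel_measurable M" "d m \<in> borel_measurable M" for m
    by (auto simp: v_def d_def[abs_def])
  have dsq: "integrable M (\<lambda>w. (d m w)\<^sup>2)" for m
  proof (rule integrableI_bounded)
    show "(\<integral>\<^sup>+ w. ennreal (norm ((d m w)\<^sup>2)) \<partial>M) < \<infinity>"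
      using N[of "m + N"] less_trans[OF _ ennreal_one_less_top] by (simp add: d_def v_def)
  qed measurable
  have Zeq: "Z w = v m w + (- d m w)" for m w by (simp add: d_def)
  have vsq: "integrable M (\<lambda>w. (v m w)\<^sup>2)" for m by (simp add: v_def sq)
  show Zsq: "integrable M (\<lambda>w. (Z w)\<^sup>2)"
    by (subst Zeq[of _ 0], rule integrable_square_add) (auto simp: vsq dsq)
  have int: "integrable M Z" "integrable M (v m)" "integrable M (d m)" "integrable M (\<lambda>w. \<bar>d m w\<bar>)" for m
    using square_integrable_imp_integrable[OF _ Zsq] square_integrable_imp_integrable[OF _ vsq]
      square_integrable_imp_integrable[OF _ dsq] by auto
  define e where "e m = expectation (\<lambda>w. (d m w)\<^sup>2)" for m
  have e0: "0 \<le> e m" for m by (simp add: e_def)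
  have e: "e \<longlonglongrightarrow> 0"
  proof -
    have "(\<lambda>m. \<integral>\<^sup>+ w. ennreal ((u (m + N) w - Z w)\<^sup>2) \<partial>M) \<longlonglongrightarrow> 0"
      using LIMSEQ_ignore_initial_segment[OF lim, of N] .
    moreover have "(\<integral>\<^sup>+ w. ennreal ((u (m + N) w - Z w)\<^sup>2) \<partial>M) = ennreal (e m)" for m
      using nn_integral_eq_integral[OF dsq[of m]] by (simp add: e_def d_def v_def)
    ultimately show ?thesis using e0 by (simp add: ennreal_tendsto_0_iff)
  qed
  \<comment> \<open>Nonnegativity of the variance of the absolute difference plays the part of
    Cauchy-Schwarz.\<close>
  have abs_le: "expectation (\<lambda>w. \<bar>d m w\<bar>) \<le> sqrt (e m)" for m
  proof (rule real_le_rsqrt)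
    have "0 \<le> variance (\<lambda>w. \<bar>d m w\<bar>)" by (rule variance_positive)
    also have "\<dots> = e m - (expectation (\<lambda>w. \<bar>d m w\<bar>))\<^sup>2"
      by (subst variance_eq) (use int dsq in \<open>auto simp: e_def\<close>)
    finally show "(expectation (\<lambda>w. \<bar>d m w\<bar>))\<^sup>2 \<le> e m" by simp
  qed
  have sqrt_e: "(\<lambda>m. sqrt (e m)) \<longlonglongrightarrow> 0" using tendsto_real_sqrt[OF e] by simp
  have Eabs: "(\<lambda>m. expectation (\<lambda>w. \<bar>d m w\<bar>)) \<longlonglongrightarrow> 0"
    by (rule tendsto_sandwich[OF _ _ tendsto_const sqrt_e]) (auto simp: abs_le)
  have Ed: "(\<lambda>m. expectation (d m)) \<longlonglongrightarrow> 0"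
    by (rule tendsto_rabs_zero_cancel, rule tendsto_sandwich[OF _ _ tendsto_const Eabs])
       (auto intro: integral_abs_bound)
  have Ev: "expectation (v m) = expectation Z + expectation (d m)" for m
    using int by (simp add: Bochner_Integration.integral_add[symmetric] d_def)
  have Ev_lim: "(\<lambda>m. expectation (v m)) \<longlonglongrightarrow> expectation Z"
    unfolding Ev using tendsto_add[OF tendsto_const Ed, of "expectation Z"] by simp
  \<comment> \<open>The second summand only keeps \<open>\<eta> m\<close> positive, for the division in the AM-GM step.\<close>
  define \<eta> where "\<eta> m = sqrt (e m) + inverse (real (Suc m))" for m
  have eta: "\<eta> \<longlonglongrightarrow> 0"
    unfolding \<eta>_def using tendsto_add[OF sqrt_e LIMSEQ_inverse_real_of_nat] by simp
  have eta0: "0 < \<eta> m" for m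
    unfolding \<eta>_def using e0[of m] by (intro add_nonneg_pos) auto
  have Zd: "integrable M (\<lambda>w. Z w * d m w)" for m
  proof (rule Bochner_Integration.integrable_bound)
    show "integrable M (\<lambda>w. (Z w)\<^sup>2 + (d m w)\<^sup>2)" using Zsq dsq by simp
    show "AE w in M. norm (Z w * d m w) \<le> norm ((Z w)\<^sup>2 + (d m w)\<^sup>2)"
      using abs_mult_le_sum_squares by simp
  qed measurable
  have Zd_le: "\<bar>expectation (\<lambda>w. Z w * d m w)\<bar> \<le> \<eta> m * (expectation (\<lambda>w. (Z w)\<^sup>2) + 1)" for m
  proof -
    have amgm: "\<bar>x * y\<bar> \<le> \<eta> m * x\<^sup>2 + y\<^sup>2 / \<eta> m" for x y :: real
    proof -
      have "\<bar>x * y\<bar> = \<bar>(sqrt (\<eta> m) * x) * (y / sqrt (\<eta> m))\<bar>"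
        using eta0[of m] by simp
      also have "\<dots> \<le> (sqrt (\<eta> m) * x)\<^sup>2 + (y / sqrt (\<eta> m))\<^sup>2"
        by (rule abs_mult_le_sum_squares)
      also have "\<dots> = \<eta> m * x\<^sup>2 + y\<^sup>2 / \<eta> m"
        using eta0[of m] by (simp add: power_mult_distrib power_divide)
      finally show ?thesis .
    qed
    have "\<bar>expectation (\<lambda>w. Z w * d m w)\<bar> \<le> expectation (\<lambda>w. \<bar>Z w * d m w\<bar>)"
      by (rule integral_abs_bound)
    also have "\<dots> \<le> expectation (\<lambda>w. \<eta> m * (Z w)\<^sup>2 + (d m w)\<^sup>2 / \<eta> m)"
      using Zd[of m] Zsq dsq[of m] amgm by (intro integral_mono) auto
    also have "\<dots> = \<eta> m * expectation (\<lambda>w. (Z w)\<^sup>2) + e m / \<eta> m"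
      using Zsq dsq[of m] by (simp add: e_def)
    also have "e m / \<eta> m \<le> \<eta> m"
    proof -
      have "e m = (sqrt (e m))\<^sup>2" using e0[of m] by simp
      also have "\<dots> \<le> (\<eta> m)\<^sup>2" by (intro power_mono) (auto simp: \<eta>_def e0)
      finally show ?thesis using eta0[of m] by (simp add: divide_le_eq power2_eq_square)
    qed
    finally show ?thesis by (simp add: algebra_simps)
  qed
  have Zd_lim: "(\<lambda>m. expectation (\<lambda>w. Z w * d m w)) \<longlonglongrightarrow> 0"
  proof (rule tendsto_rabs_zero_cancel, rule tendsto_sandwich[OF _ _ tendsto_const])
    show "(\<lambda>m. \<eta> m * (expectation (\<lambda>w. (Z w)\<^sup>2) + 1)) \<longlonglongrightarrow> 0"
      using tendsto_mult_right[OF eta] by simp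
  qed (auto simp: Zd_le)
  have Ev2: "expectation (\<lambda>w. (v m w)\<^sup>2) = expectation (\<lambda>w. (Z w)\<^sup>2)
      + 2 * expectation (\<lambda>w. Z w * d m w) + e m" for m
  proof -
    have "expectation (\<lambda>w. (v m w)\<^sup>2) = expectation (\<lambda>w. ((Z w)\<^sup>2 + 2 * (Z w * d m w)) + (d m w)\<^sup>2)"
      by (rule Bochner_Integration.integral_cong) (auto simp: d_def power2_eq_square algebra_simps)
    also have "\<dots> = expectation (\<lambda>w. (Z w)\<^sup>2) + 2 * expectation (\<lambda>w. Z w * d m w) + e m"
      using Zsq Zd[of m] dsq[of m] by (simp add: e_def)
    finally show ?thesis .
  qed
  have Var_lim: "(\<lambda>m. variance (v m)) \<longlonglongrightarrow> variance Z"
  proof -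
    have "(\<lambda>m. expectation (\<lambda>w. (v m w)\<^sup>2) - (expectation (v m))\<^sup>2)
        \<longlonglongrightarrow> (expectation (\<lambda>w. (Z w)\<^sup>2) + 2 * 0 + 0) - (expectation Z)\<^sup>2"
      unfolding Ev2 by (intro tendsto_intros Zd_lim e Ev_lim)
    then show ?thesis using int Zsq vsq by (simp add: variance_eq)
  qed
  obtain r where r: "strict_mono r" "AE w in M. (\<lambda>m. d (r m) w) \<longlonglongrightarrow> 0"
    using tendsto_L1_AE_subseq[of M d] int Eabs by auto
  show "subgaussian M (\<lambda>w. Z w - expectation Z) (variance Z)"
    unfolding subgaussian_def
  proof (intro conjI allI)
    fix c :: real
    define h where "h m w = ennreal (exp (c * (v (r m) w - expectation (v (r m)))))" for m w
    have [measurable]: "h m \<in> borel_measurable M" for m by (simp add: h_def[abs_def])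
    have "AE w in M. ennreal (exp (c * (Z w - expectation Z))) = liminf (\<lambda>m. h m w)"
      using r(2)
    proof eventually_elim
      fix w assume *: "(\<lambda>m. d (r m) w) \<longlonglongrightarrow> 0"
      have "(\<lambda>m. v (r m) w) \<longlonglongrightarrow> Z w"
        using tendsto_add[OF * tendsto_const, of "Z w"] by (simp add: d_def)
      moreover have "(\<lambda>m. expectation (v (r m))) \<longlonglongrightarrow> expectation Z"
        using LIMSEQ_subseq_LIMSEQ[OF Ev_lim r(1)] by (simp add: comp_def)
      ultimately have "(\<lambda>m. h m w) \<longlonglongrightarrow> ennreal (exp (c * (Z w - expectation Z)))"
        unfolding h_def by (intro tendsto_ennrealI tendsto_intros)
      then show "ennreal (exp (c * (Z w - expectation Z))) = liminf (\<lambda>m. h m w)"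
        by (simp add: lim_imp_Liminf)
    qed
    then have "(\<integral>\<^sup>+ w. ennreal (exp (c * (Z w - expectation Z))) \<partial>M) = (\<integral>\<^sup>+ w. liminf (\<lambda>m. h m w) \<partial>M)"
      by (rule nn_integral_cong_AE)
    also have "\<dots> \<le> liminf (\<lambda>m. \<integral>\<^sup>+ w. h m w \<partial>M)"
      by (rule nn_integral_liminf) measurable
    also have "\<dots> \<le> liminf (\<lambda>m. ennreal (exp (c\<^sup>2 * variance (v (r m)) / 2)))"
      using subgaussianD(2)[OF sg] by (intro Liminf_mono always_eventually allI) (simp add: h_def v_def)
    also have "\<dots> = ennreal (exp (c\<^sup>2 * variance Z / 2))"
    proof (rule lim_imp_Liminf)
      have "(\<lambda>m. variance (v (r m))) \<longlonglongrightarrow> variance Z"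
        using LIMSEQ_subseq_LIMSEQ[OF Var_lim r(1)] by (simp add: comp_def)
      then show "(\<lambda>m. ennreal (exp (c\<^sup>2 * variance (v (r m)) / 2))) \<longlonglongrightarrow> ennreal (exp (c\<^sup>2 * variance Z / 2))"
        by (intro tendsto_ennrealI tendsto_intros) auto
    qed simp
    finally show "(\<integral>\<^sup>+ w. ennreal (exp (c * (Z w - expectation Z))) \<partial>M) \<le> ennreal (exp (c\<^sup>2 * variance Z / 2))" .
  qed measurable
qed

lemma linear_estimator_subgaussian:
  assumes B: "brownian_motion M W" and n: "0 < n" and S: "linear_estimator M W n S" and f: "f \<in> L2"
  shows "S f \<in> borel_measurable M" "integrable M (\<lambda>w. (S f w)\<^sup>2)"
    "subgaussian M (\<lambda>w. S f w - prob_space.expectation M (S f)) (prob_space.variance M (S f))"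
proof -
  interpret prob_space M using B by (simp add: brownian_motion_def)
  obtain a k where "has_stoch_integral M (obs W n f) k (\<lambda>w. S f w - a)"
    using S f unfolding linear_estimator_def by blast
  then obtain p where m: "(\<lambda>w. S f w - a) \<in> borel_measurable M" and p: "\<And>m. valid_step (p m)"
    and lim: "(\<lambda>m. \<integral>\<^sup>+ w. ennreal ((step_integral (p m) (obs W n f) w - (S f w - a))\<^sup>2) \<partial>M) \<longlonglongrightarrow> 0"
    unfolding has_stoch_integral_def by blast
  define u where "u m w = step_integral (p m) (obs W n f) w + a" for m w
  have g: "gaussian_rv M (u m)" for m
    using brownian_step_gaussian[OF B p n, of m f a] by (simp add: u_def[abs_def])
  have "(\<lambda>w. (S f w - a) + a) \<in> borel_measurable M" using m by (intro borel_measurable_add) auto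
  then show Sm: "S f \<in> borel_measurable M" by simp
  have lim': "(\<lambda>m. \<integral>\<^sup>+ w. ennreal ((u m w - S f w)\<^sup>2) \<partial>M) \<longlonglongrightarrow> 0"
    using lim by (simp add: u_def algebra_simps)
  show "integrable M (\<lambda>w. (S f w)\<^sup>2)" "subgaussian M (\<lambda>w. S f w - expectation (S f)) (variance (S f))"
    using subgaussian_limit[OF gaussian_rv_subgaussian(1)[OF g] gaussian_rv_subgaussian(2)[OF g]
      gaussian_rv_subgaussian(3)[OF g] Sm lim'] by auto
qed

section \<open>Mean bounds, tails and fourth moments\<close>

text \<open>A calculus of upper bounds for expectations of nonnegative variables, closed under sums
  and scaling without integrability conditions. The clause \<open>0 \<le> c\<close> matters because
  \<open>ennreal\<close> sends negative reals to zero.\<close>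

definition mean_le :: "'w measure \<Rightarrow> ('w \<Rightarrow> real) \<Rightarrow> real \<Rightarrow> bool" where
  "mean_le M f c \<longleftrightarrow> f \<in> borel_measurable M \<and> (\<forall>w. 0 \<le> f w) \<and> 0 \<le> c \<and>
     (\<integral>\<^sup>+ w. ennreal (f w) \<partial>M) \<le> ennreal c"

lemma mean_le_mono:
  assumes "mean_le M g c" "f \<in> borel_measurable M" "\<And>w. 0 \<le> f w" "\<And>w. f w \<le> g w" "c \<le> c'"
  shows "mean_le M f c'"
proof -
  have "(\<integral>\<^sup>+ w. ennreal (f w) \<partial>M) \<le> (\<integral>\<^sup>+ w. ennreal (g w) \<partial>M)"
    by (intro nn_integral_mono ennreal_leI assms)
  also have "\<dots> \<le> ennreal c" using assms(1) by (simp add: mean_le_def)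
  also have "\<dots> \<le> ennreal c'" using assms(5) by (rule ennreal_leI)
  finally show ?thesis using assms unfolding mean_le_def by auto
qed

lemma mean_le_weaken: "mean_le M f c \<Longrightarrow> c \<le> c' \<Longrightarrow> mean_le M f c'"
  unfolding mean_le_def by (auto intro: order_trans ennreal_leI)

lemma mean_le_add:
  assumes "mean_le M f a" "mean_le M g b"
  shows "mean_le M (\<lambda>w. f w + g w) (a + b)"
  using assms by (auto simp: mean_le_def nn_integral_add intro!: add_mono)

lemma mean_le_cmult:
  assumes "mean_le M f a" "0 \<le> c"
  shows "mean_le M (\<lambda>w. c * f w) (c * a)"
  using assms by (auto simp: mean_le_def nn_integral_cmult ennreal_mult intro!: mult_left_mono)

lemma mean_le_sum:
  assumes "\<And>i. i \<in> I \<Longrightarrow> mean_le M (f i) (a i)"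
  shows "mean_le M (\<lambda>w. \<Sum>i\<in>I. f i w) (\<Sum>i\<in>I. a i)"
  using assms
proof (induction I rule: infinite_finite_induct)
  case (insert i I)
  then show ?case by (simp add: mean_le_add)
qed (simp_all add: mean_le_def)

lemma (in prob_space) mean_le_const: "0 \<le> c \<Longrightarrow> mean_le M (\<lambda>_. c) c"
  by (simp add: mean_le_def emeasure_space_1)

text \<open>Cauchy-Schwarz as a pointwise weighted AM-GM inequality. The weights balance the two
  terms, each of which contributes \<open>\<alpha> * \<beta> / 2\<close>.\<close>

lemma mean_le_times_square:
  assumes "mean_le M (\<lambda>w. of_bool (P w)) (\<alpha>\<^sup>2)" "mean_le M (\<lambda>w. (X w)^4) (\<beta>\<^sup>2)"
    and [measurable]: "X \<in> borel_measurable M" and pos: "0 < \<alpha>" "0 < \<beta>"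
  shows "mean_le M (\<lambda>w. of_bool (P w) * (X w)\<^sup>2) (\<alpha> * \<beta>)"
proof (rule mean_le_mono)
  show "mean_le M (\<lambda>w. \<beta> / (2 * \<alpha>) * of_bool (P w) + \<alpha> / (2 * \<beta>) * (X w)^4)
    (\<beta> / (2 * \<alpha>) * \<alpha>\<^sup>2 + \<alpha> / (2 * \<beta>) * \<beta>\<^sup>2)"
    using assms by (intro mean_le_add mean_le_cmult) auto
  show "(\<lambda>w. of_bool (P w) * (X w)\<^sup>2) \<in> borel_measurable M"
    using assms(1) by (intro borel_measurable_times) (auto simp: mean_le_def)
  show "of_bool (P w) * (X w)\<^sup>2 \<le> \<beta> / (2 * \<alpha>) * of_bool (P w) + \<alpha> / (2 * \<beta>) * (X w)^4" for w
  proof (cases "P w")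
    case True
    have "0 \<le> (\<beta> - \<alpha> * (X w)\<^sup>2)\<^sup>2 / (2 * \<alpha> * \<beta>)" using pos by simp
    also have "\<dots> = \<beta> / (2 * \<alpha>) + \<alpha> / (2 * \<beta>) * (X w)^4 - (X w)\<^sup>2"
      using pos by (simp add: power2_diff field_simps power2_eq_square power4_eq_xxxx)
    finally show ?thesis using True by simp
  next
    case False
    then show ?thesis using pos by simp
  qed
  show "\<beta> / (2 * \<alpha>) * \<alpha>\<^sup>2 + \<alpha> / (2 * \<beta>) * \<beta>\<^sup>2 \<le> \<alpha> * \<beta>"
    using pos by (simp add: field_simps power2_eq_square)
qed simp

section \<open>Moments and tails of sub-Gaussian variables\<close>

lemma subgaussian_exp: "subgaussian M Z v \<Longrightarrow> mean_le M (\<lambda>w. exp (c * Z w)) (exp (c\<^sup>2 * v / 2))"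
  unfolding mean_le_def by (auto intro: subgaussianD(2) dest: subgaussianD(1))

text \<open>The inequality \<open>y / 4 \<le> exp (y / 4)\<close> is raised to the fourth power,
  whence 256 = 4^4. The sum of both exponentials treats either sign of \<open>x\<close>.\<close>

lemma power4_le_exp: "x^4 \<le> 256 * (exp x + exp (- x))" for x :: real
proof -
  have *: "y^4 \<le> 256 * exp y" if "0 \<le> y" for y :: real
  proof -
    have "y/4 \<le> exp (y/4)" using exp_ge_add_one_self[of "y/4"] by linarith
    then have "(y/4)^4 \<le> (exp (y/4))^4" using that by (intro power_mono) auto
    also have "\<dots> = exp y" by (simp add: exp_of_nat_mult[symmetric])
    finally show ?thesis by (simp add: power_divide)
  qed
  show ?thesis
  proof (cases "0 \<le> x")
    case True
    then show ?thesis using *[of x] exp_gt_zero[of "- x"] unfolding distrib_left by linarith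
  next
    case False
    then have "(- x)^4 \<le> 256 * exp (- x)" by (intro *) simp
    then have "x^4 \<le> 256 * exp (- x)" by simp
    then show ?thesis using exp_gt_zero[of x] unfolding distrib_left by linarith
  qed
qed

lemma (in prob_space) subgaussian_fourth_moment:
  assumes "subgaussian M Z v" "0 < v"
  shows "mean_le M (\<lambda>w. (Z w)^4) (1024 * v\<^sup>2)"
proof (rule mean_le_mono)
  \<comment> \<open>This scale normalises the proxy to 1, so each exponential has mean at most
    \<open>exp (1/2) \<le> 2\<close>, and 1024 = 256 * 2 * 2.\<close>
  define c where "c = 1 / sqrt v"
  have c2: "c\<^sup>2 * v = 1" and c: "c \<noteq> 0" using assms(2) by (auto simp: c_def power_divide)
  have c4: "c^4 = 1 / v\<^sup>2" using assms(2) by (simp add: c_def power_divide real_sqrt_power[symmetric] power4_eq_xxxx power2_eq_square)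
  show "mean_le M (\<lambda>w. 256 * v\<^sup>2 * (exp (c * Z w) + exp ((- c) * Z w)))
     (256 * v\<^sup>2 * (exp (c\<^sup>2 * v / 2) + exp ((- c)\<^sup>2 * v / 2)))"
    by (intro mean_le_cmult mean_le_add subgaussian_exp assms) simp
  show "(Z w)^4 \<le> 256 * v\<^sup>2 * (exp (c * Z w) + exp ((- c) * Z w))" for w
  proof -
    have "(c * Z w)^4 \<le> 256 * (exp (c * Z w) + exp (- (c * Z w)))" by (rule power4_le_exp)
    then show ?thesis using assms(2) by (simp add: power_mult_distrib c4 field_simps)
  qed
  show "256 * v\<^sup>2 * (exp (c\<^sup>2 * v / 2) + exp ((- c)\<^sup>2 * v / 2)) \<le> 1024 * v\<^sup>2"
    using exp_half_le2 mult_left_mono[OF exp_half_le2, of "512 * v\<^sup>2"] by (simp add: c2)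
  show "(\<lambda>w. (Z w)^4) \<in> borel_measurable M"
    using subgaussianD(1)[OF assms(1)] by measurable
qed simp

text \<open>Follows from the fourth moment through \<open>z\<^sup>2 \<le> v + z^4 / v\<close>,
  whence 1025 = 1 + 1024.\<close>

lemma (in prob_space) subgaussian_second_moment:
  assumes "subgaussian M Z v" "0 < v"
  shows "mean_le M (\<lambda>w. (Z w)\<^sup>2) (1025 * v)"
proof (rule mean_le_mono)
  show "mean_le M (\<lambda>w. v + 1 / v * (Z w)^4) (v + 1 / v * (1024 * v\<^sup>2))"
    using assms by (intro mean_le_add mean_le_cmult mean_le_const subgaussian_fourth_moment) auto
  show "(Z w)\<^sup>2 \<le> v + 1 / v * (Z w)^4" for w
  proof -
    have "0 \<le> (v - (Z w)\<^sup>2)\<^sup>2 + v * (Z w)\<^sup>2" using assms(2) by simp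
    then have "v * (Z w)\<^sup>2 \<le> v * v + (Z w)^4"
      by (simp add: power2_diff power2_eq_square power4_eq_xxxx algebra_simps)
    then show ?thesis using assms(2) by (simp add: field_simps)
  qed
  show "v + 1 / v * (1024 * v\<^sup>2) \<le> 1025 * v" using assms(2) by (simp add: power2_eq_square)
  show "(\<lambda>w. (Z w)\<^sup>2) \<in> borel_measurable M"
    using subgaussianD(1)[OF assms(1)] by measurable
qed simp

lemma subgaussian_tail:
  assumes "subgaussian M Z v" "0 < v" "0 \<le> t"
  shows "mean_le M (\<lambda>w. of_bool (t \<le> \<bar>Z w\<bar>)) (2 * exp (- t\<^sup>2 / (2 * v)))"
proof (rule mean_le_mono)
  \<comment> \<open>The optimal exponent in Chernoff's bound; adding the exponentials of both signs
    covers the absolute value.\<close>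
  define c where "c = t / v"
  show "mean_le M (\<lambda>w. exp (- c * t) * (exp (c * Z w) + exp ((- c) * Z w)))
     (exp (- c * t) * (exp (c\<^sup>2 * v / 2) + exp ((- c)\<^sup>2 * v / 2)))"
    by (intro mean_le_cmult mean_le_add subgaussian_exp assms) simp
  show "of_bool (t \<le> \<bar>Z w\<bar>) \<le> exp (- c * t) * (exp (c * Z w) + exp ((- c) * Z w))" for w
  proof (cases "t \<le> \<bar>Z w\<bar>")
    case True
    have c0: "0 \<le> c" using assms by (simp add: c_def)
    have "exp (- c * t) * exp (c * \<bar>Z w\<bar>) \<ge> 1"
      using mult_left_mono[OF True c0] by (simp add: exp_add[symmetric])
    moreover have "exp (c * \<bar>Z w\<bar>) \<le> exp (c * Z w) + exp ((- c) * Z w)"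
      by (cases "0 \<le> Z w") auto
    ultimately have "1 \<le> exp (- c * t) * (exp (c * Z w) + exp ((- c) * Z w))"
      by (meson exp_ge_zero mult_left_mono order_trans)
    then show ?thesis using True by simp
  qed simp
  have "- c * t + c\<^sup>2 * v / 2 = - t\<^sup>2 / (2 * v)"
    using assms(2) by (simp add: c_def field_simps power2_eq_square)
  then have "exp (- c * t) * exp (c\<^sup>2 * v / 2) = exp (- t\<^sup>2 / (2 * v))"
    by (simp add: exp_add[symmetric])
  then show "exp (- c * t) * (exp (c\<^sup>2 * v / 2) + exp ((- c)\<^sup>2 * v / 2)) \<le> 2 * exp (- t\<^sup>2 / (2 * v))"
    by (simp add: algebra_simps)
  show "(\<lambda>w. of_bool (t \<le> \<bar>Z w\<bar>) :: real) \<in> borel_measurable M"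
    using subgaussianD(1)[OF assms(1)] by measurable
qed simp

lemma power4_add_le: "(x + y)^4 \<le> 8 * (x^4 + y^4)" for x y :: real
proof -
  have sq: "(a + b)\<^sup>2 \<le> 2 * (a\<^sup>2 + b\<^sup>2)" for a b :: real
    using sum_squares_bound[of a b] by (simp add: power2_sum)
  have "(x + y)^4 = ((x + y)\<^sup>2)\<^sup>2" by simp
  also have "\<dots> \<le> (2 * (x\<^sup>2 + y\<^sup>2))\<^sup>2" by (intro power_mono sq) simp
  also have "\<dots> = 4 * (x\<^sup>2 + y\<^sup>2)\<^sup>2" by (simp only: power_mult_distrib) simp
  also have "\<dots> \<le> 4 * (2 * ((x\<^sup>2)\<^sup>2 + (y\<^sup>2)\<^sup>2))" by (intro mult_left_mono sq) simp
  finally show ?thesis by simp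
qed

text \<open>The bound is written as a square because \<open>mean_le_times_square\<close> uses its
  root. Numerically, 8 * (1 + 1024) = 8200 is below 100^2.\<close>

lemma (in prob_space) shifted_fourth_moment:
  assumes "subgaussian M Z (s\<^sup>2)" "0 < s" "\<bar>b\<bar> \<le> s"
  shows "mean_le M (\<lambda>w. (b + Z w)^4) ((100 * s\<^sup>2)\<^sup>2)"
proof (rule mean_le_mono)
  show "mean_le M (\<lambda>w. 8 * (b^4 + (Z w)^4)) (8 * (b^4 + 1024 * (s\<^sup>2)\<^sup>2))"
    using assms by (intro mean_le_add mean_le_cmult mean_le_const subgaussian_fourth_moment) auto
  have "b^4 \<le> s^4" using power_mono[OF assms(3), of 4] by simp
  moreover have "0 \<le> s^4" using assms(2) by simp
  ultimately have "8 * b^4 \<le> 1808 * s^4" by linarith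
  then show "8 * (b^4 + 1024 * (s\<^sup>2)\<^sup>2) \<le> (100 * s\<^sup>2)\<^sup>2"
    by (simp add: power_mult_distrib)
  show "(\<lambda>w. (b + Z w)^4) \<in> borel_measurable M"
    using subgaussianD(1)[OF assms(1)] by measurable
  show "(b + Z w)^4 \<le> 8 * (b^4 + (Z w)^4)" for w by (rule power4_add_le)
qed simp

lemma mean_le_markov4:
  assumes "mean_le M (\<lambda>w. (X w)^4) c" and [measurable]: "X \<in> borel_measurable M" and "0 < t"
  shows "mean_le M (\<lambda>w. of_bool (t \<le> \<bar>X w\<bar>)) (c / t^4)"
proof (rule mean_le_mono)
  show "mean_le M (\<lambda>w. 1 / t^4 * (X w)^4) (1 / t^4 * c)"
    using assms by (intro mean_le_cmult) auto
  show "of_bool (t \<le> \<bar>X w\<bar>) \<le> 1 / t^4 * (X w)^4" for w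
    using power_mono[of t "\<bar>X w\<bar>" 4] assms(3) by (auto simp: of_bool_def)
qed auto

section \<open>Risk of the selected estimator\<close>

definition passes ::
    "((real \<Rightarrow> real) \<Rightarrow> real) \<Rightarrow> nat \<Rightarrow> (nat \<Rightarrow> (real \<Rightarrow> real) set) \<Rightarrow>
     'w estimator \<Rightarrow> (nat \<Rightarrow> nat \<Rightarrow> 'w estimator) \<Rightarrow> nat \<Rightarrow> nat \<Rightarrow> (real \<Rightarrow> real) \<Rightarrow> 'w \<Rightarrow> bool" where
  "passes T n G S1 S i j f w \<longleftrightarrow>
     S i j f w - 11/2 * rmodulus T (logrt n) (G j) (G j) \<le> single_est S1 S i f w \<and>
     single_est S1 S i f w \<le> S j i f w + 11/2 * rmodulus T (logrt n) (G j) (G j)"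

lemma accept_eq:
  "accept T n G k S1 S i f w = of_bool (\<forall>j\<in>{i<..k}. passes T n G S1 S i j f w)"
proof -
  have "(\<Prod>j\<in>A. of_bool (Q j) :: real) = of_bool (\<forall>j\<in>A. Q j)" if "finite A" for A :: "nat set" and Q
    using that by (induction A rule: finite_induct) auto
  then show ?thesis unfolding accept_def pair_test_def passes_def by simp
qed

text \<open>The products of indicators vanish except at the least accepted index, which exists
  because the last index faces no test. Minimality supplies a failed test for each smaller
  index.\<close>

lemma adaptive_estimator_selects:
  assumes "1 \<le> k"
  obtains j where "1 \<le> j" "j \<le> k"
    "\<And>m. j < m \<Longrightarrow> m \<le> k \<Longrightarrow> passes T n G S1 S j m f w"
    "\<And>i. 1 \<le> i \<Longrightarrow> i < j \<Longrightarrow> \<exists>m. i < m \<and> m \<le> k \<and> \<not> passes T n G S1 S i m f w"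
    "adaptive_estimator T n G k S1 S f w = single_est S1 S j f w"
proof -
  define P where "P j \<longleftrightarrow> 1 \<le> j \<and> j \<le> k \<and> (\<forall>m\<in>{j<..k}. passes T n G S1 S j m f w)" for j
  define j where "j = (LEAST j. P j)"
  have "P k" using assms by (auto simp: P_def)
  then have Pj: "P j" unfolding j_def by (rule LeastI)
  have below: "\<not> P i" if "i < j" for i using that unfolding j_def by (rule not_less_Least)
  let ?A = "\<lambda>i. accept T n G k S1 S i f w"
  have A: "?A i = of_bool (P i)" if "1 \<le> i" "i \<le> k" for i
    using that by (simp add: accept_eq P_def)
  have "adaptive_estimator T n G k S1 S f w
      = (\<Sum>i\<in>{1..k}. if i = j then single_est S1 S j f w else 0)"
    unfolding adaptive_estimator_def
  proof (rule sum.cong[OF refl])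
    fix i assume i: "i \<in> {1..k}"
    show "(\<Prod>m\<in>{1..<i}. 1 - ?A m) * ?A i * single_est S1 S i f w
        = (if i = j then single_est S1 S j f w else 0)"
    proof (cases i j rule: linorder_cases)
      case less
      then show ?thesis using A[of i] below i by simp
    next
      case equal
      have "(\<Prod>m\<in>{1..<i}. 1 - ?A m) = 1"
        using A below i equal by (intro prod.neutral) auto
      then show ?thesis using A[of i] Pj i equal by simp
    next
      case greater
      have "(\<Prod>m\<in>{1..<i}. 1 - ?A m) = 0"
        using A[of j] Pj i greater by (intro prod_zero) (auto simp: P_def)
      then show ?thesis using greater by simp
    qed
  qed
  then have "adaptive_estimator T n G k S1 S f w = single_est S1 S j f w"
    using Pj by (simp add: P_def)
  then show thesis
    using Pj below by (intro that[of j]) (fastforce simp: P_def)+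
qed

text \<open>The count starts at 2 because the grid need not double from its first to its second
  point.\<close>

lemma doubling_geometric:
  fixes \<omega> :: "nat \<Rightarrow> real"
  assumes "\<And>j. 2 \<le> j \<Longrightarrow> Suc j \<le> k \<Longrightarrow> 2 * \<omega> j \<le> \<omega> (Suc j)" and "2 \<le> m" "m \<le> k"
  shows "2^(m - 2) * \<omega> 2 \<le> \<omega> m"
  using assms(2,3)
proof (induction m rule: dec_induct)
  case (step p)
  have "Suc p - 2 = Suc (p - 2)" using step by simp
  then have "2 ^ (Suc p - 2) * \<omega> 2 = 2 * (2 ^ (p - 2) * \<omega> 2)"
    by (simp only: power_Suc mult.assoc)
  also have "\<dots> \<le> 2 * \<omega> p" using step by simp
  also have "\<dots> \<le> \<omega> (Suc p)" using assms(1) step by simp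
  finally show ?case .
qed simp

text \<open>One fixed true function \<open>f\<close> in the \<open>i\<close>-th grid class:
  \<open>\<theta>\<close> is \<open>T f\<close>, \<open>L\<close> is \<open>ln n\<close>, so
  \<open>exp L\<close> is the sample size. \<open>U j\<close> is the \<open>j\<close>-th candidate;
  the pair estimator \<open>Y a b\<close> splits into \<open>\<theta>\<close>, bias
  \<open>\<beta> a b\<close> and centred error \<open>Z a b\<close>. Each bias is bounded only on
  the side where \<open>f\<close> is known to lie in the relevant class. The target rate is
  \<open>\<tau>\<close>; \<open>K\<close> and \<open>C0\<close> control the spread of the moduli and
  the number of grid points.\<close>

locale selection_bounds = prob_space M for M :: "'w measure" +
  fixes U :: "nat \<Rightarrow> 'w \<Rightarrow> real" and Y Z :: "nat \<Rightarrow> nat \<Rightarrow> 'w \<Rightarrow> real"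
    and \<beta> :: "nat \<Rightarrow> nat \<Rightarrow> real" and \<omega> :: "nat \<Rightarrow> real"
    and k i :: nat and L \<tau> \<theta> K C0 :: real
  assumes i: "1 \<le> i" "i \<le> k" and L: "1 \<le> L"
    and \<omega>_pos: "\<And>j. 1 \<le> j \<Longrightarrow> j \<le> k \<Longrightarrow> 0 < \<omega> j"
    and \<omega>_mono: "\<And>j m. 1 \<le> j \<Longrightarrow> j \<le> m \<Longrightarrow> m \<le> k \<Longrightarrow> \<omega> j \<le> \<omega> m"
    and \<omega>_double: "\<And>j. 2 \<le> j \<Longrightarrow> Suc j \<le> k \<Longrightarrow> 2 * \<omega> j \<le> \<omega> (Suc j)"
    and U: "\<And>j. 2 \<le> j \<Longrightarrow> U j = Y j j"
    and Y: "\<And>a b w. a \<in> {1..k} \<Longrightarrow> b \<in> {1..k} \<Longrightarrow> 2 \<le> max a b \<Longrightarrow> Y a b w = \<theta> + \<beta> a b + Z a b w"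
    and Z: "\<And>a b. a \<in> {1..k} \<Longrightarrow> b \<in> {1..k} \<Longrightarrow> 2 \<le> max a b \<Longrightarrow>
      subgaussian M (Z a b) ((\<omega> (max a b))\<^sup>2 / L)"
    and \<beta>_le: "\<And>a b. a \<in> {1..k} \<Longrightarrow> b \<in> {1..k} \<Longrightarrow> 2 \<le> max a b \<Longrightarrow> i \<le> a \<Longrightarrow> \<beta> a b \<le> \<omega> (max a b) / 2"
    and \<beta>_ge: "\<And>a b. a \<in> {1..k} \<Longrightarrow> b \<in> {1..k} \<Longrightarrow> 2 \<le> max a b \<Longrightarrow> i \<le> b \<Longrightarrow> - (\<omega> (max a b) / 2) \<le> \<beta> a b"
    and \<tau>: "0 < \<tau>" "2 \<le> i \<Longrightarrow> \<tau> = \<omega> i"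
    and \<omega>_le: "\<And>j. 1 \<le> j \<Longrightarrow> j \<le> k \<Longrightarrow> (\<omega> j)\<^sup>2 \<le> K * exp L * \<tau>\<^sup>2"
    and k_le: "real k \<le> C0 * L" and L_le: "L\<^sup>2 \<le> exp (L / 4)"
    and K: "0 \<le> K"
    and first: "i = 1 \<Longrightarrow> mean_le M (\<lambda>w. (U 1 w - \<theta>)\<^sup>2) (\<tau>\<^sup>2)"
      "i = 1 \<Longrightarrow> U 1 \<in> borel_measurable M"
      "i = 1 \<Longrightarrow> mean_le M (\<lambda>w. (U 1 w - \<theta>)^4) ((100 * \<tau>\<^sup>2)\<^sup>2)"
begin

definition pass :: "nat \<Rightarrow> nat \<Rightarrow> 'w \<Rightarrow> bool" where
  "pass j m w \<longleftrightarrow> Y j m w - 11/2 * \<omega> m \<le> U j w \<and> U j w \<le> Y m j w + 11/2 * \<omega> m"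

definition far :: "real \<Rightarrow> real \<Rightarrow> real" where "far t x = of_bool (t \<le> \<bar>x\<bar>)"

text \<open>
  \<open>dev j m\<close> counts the large deviations one of which must occur if the \<open>(j - 1)\<close>-st
  estimator fails its test against class \<open>m\<close>. The first estimator is kept apart: its standard
  deviation is only of order \<open>\<tau>\<close>, without the factor \<open>1 / sqrt L\<close> of the other ones,
  so that its tail is not exponentially small in \<open>L\<close>.
\<close>

definition dev :: "nat \<Rightarrow> nat \<Rightarrow> 'w \<Rightarrow> real" where
  "dev j m w = (if j = 2 then far (\<omega> m) (U 1 w - \<theta>) else far (9/4 * \<omega> m) (Z (j - 1) (j - 1) w))
     + far (9/4 * \<omega> m) (Z (j - 1) m w) + far (9/4 * \<omega> m) (Z m (j - 1) w)"

text \<open>The three groups correspond to a selected index before, at and after \<open>i\<close>.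
  Summing over all indices replaces the random choice.\<close>

definition bound :: "'w \<Rightarrow> real" where
  "bound w = (if 2 \<le> i then 72 * (\<omega> i)\<^sup>2 + 2 * (\<Sum>j\<in>{1..<i}. (Z j i w)\<^sup>2 + (Z i j w)\<^sup>2) else 0)
     + (U i w - \<theta>)\<^sup>2 + (\<Sum>j\<in>{i<..k}. \<Sum>m\<in>{j..k}. dev j m w * (U j w - \<theta>)\<^sup>2)"

lemma far_nonneg: "0 \<le> far t x" by (simp add: far_def)

lemma dev_nonneg: "0 \<le> dev j m w"
  unfolding dev_def by (auto intro!: add_nonneg_nonneg far_nonneg)

text \<open>As \<open>i \<le> j - 1\<close>, \<open>f\<close> lies in class \<open>j - 1\<close>,
  and either side of the test involves the pair estimator whose bias is controlled in the direction
  needed. A failure exceeds \<open>11/2 * \<omega> m\<close>; biases consume at most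
  \<open>\<omega> m\<close>, so one of two errors reaches half of the remaining
  \<open>9/2 * \<omega> m\<close>. For \<open>j = 2\<close> only one bias of size
  \<open>\<omega> m / 2\<close> is subtracted, and 1 + 9/4 < 5.\<close>

lemma not_pass_dev:
  assumes "i < j" "j \<le> m" "m \<le> k" "\<not> pass (j - 1) m w"
  shows "1 \<le> dev j m w"
proof -
  have rng: "j - 1 \<in> {1..k}" "m \<in> {1..k}" "2 \<le> m" "max (j - 1) m = m" "max m (j - 1) = m"
    using assms i by auto
  have w: "0 < \<omega> m" using \<omega>_pos rng by simp
  have ij: "i \<le> j - 1" using assms by simp
  have 1: "Y (j - 1) m w = \<theta> + \<beta> (j - 1) m + Z (j - 1) m w" "Y m (j - 1) w = \<theta> + \<beta> m (j - 1) + Z m (j - 1) w"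
    using Y[of "j - 1" m w] Y[of m "j - 1" w] rng by auto
  have 2: "\<beta> (j - 1) m \<le> \<omega> m / 2" "- (\<omega> m / 2) \<le> \<beta> m (j - 1)"
    using \<beta>_le[of "j - 1" m] \<beta>_ge[of m "j - 1"] rng ij by auto
  have "(if j = 2 then \<omega> m \<le> \<bar>U 1 w - \<theta>\<bar> else 9/4 * \<omega> m \<le> \<bar>Z (j - 1) (j - 1) w\<bar>)
     \<or> 9/4 * \<omega> m \<le> \<bar>Z (j - 1) m w\<bar> \<or> 9/4 * \<omega> m \<le> \<bar>Z m (j - 1) w\<bar>"
  proof (cases "j = 2")
    case True
    then show ?thesis using assms(4) 1 2 w unfolding pass_def by (simp add: abs_if) linarith
  next
    case False
    then have j: "2 \<le> j - 1" using assms i by simp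
    have "\<omega> (j - 1) \<le> \<omega> m" using \<omega>_mono rng assms by simp
    then have "\<beta> (j - 1) (j - 1) \<le> \<omega> m / 2" "- (\<omega> m / 2) \<le> \<beta> (j - 1) (j - 1)"
      using \<beta>_le[of "j - 1" "j - 1"] \<beta>_ge[of "j - 1" "j - 1"] rng ij j by auto
    moreover have "U (j - 1) w = \<theta> + \<beta> (j - 1) (j - 1) + Z (j - 1) (j - 1) w"
      using U[OF j] Y[of "j - 1" "j - 1" w] rng j by simp
    ultimately show ?thesis using assms(4) 1 2 w False unfolding pass_def by (simp add: abs_if) linarith
  qed
  then show ?thesis
    unfolding dev_def far_def by (auto split: if_splits)
qed

lemma selected_le_bound:
  assumes j: "1 \<le> j" "j \<le> k"
    and ok: "\<And>m. j < m \<Longrightarrow> m \<le> k \<Longrightarrow> pass j m w"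
    and fail: "\<And>l. 1 \<le> l \<Longrightarrow> l < j \<Longrightarrow> \<exists>m. l < m \<and> m \<le> k \<and> \<not> pass l m w"
  shows "(U j w - \<theta>)\<^sup>2 \<le> bound w"
proof -
  have nn: "0 \<le> (\<Sum>j\<in>{i<..k}. \<Sum>m\<in>{j..k}. dev j m w * (U j w - \<theta>)\<^sup>2)"
    by (intro sum_nonneg mult_nonneg_nonneg dev_nonneg) auto
  have nn2: "0 \<le> (if 2 \<le> i then 72 * (\<omega> i)\<^sup>2 + 2 * (\<Sum>j\<in>{1..<i}. (Z j i w)\<^sup>2 + (Z i j w)\<^sup>2) else 0)"
    by (auto intro!: add_nonneg_nonneg sum_nonneg)
  show ?thesis
  proof (cases j i rule: linorder_cases)
    case less
    then have i2: "2 \<le> i" and rng: "i \<in> {1..k}" "j \<in> {1..k}" "max i j = i" "max j i = i" using j i by auto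
    \<comment> \<open>Here \<open>f\<close> need not lie in class \<open>j\<close>, so the bias of
      \<open>U j\<close> is unknown. The test against \<open>i\<close> traps \<open>U j\<close>
      between two pair estimators with controlled one-sided bias; 6 = 11/2 + 1/2.\<close>
    have "pass j i w" using ok less i by simp
    moreover have "Y j i w = \<theta> + \<beta> j i + Z j i w" "Y i j w = \<theta> + \<beta> i j + Z i j w"
      using Y[of j i w] Y[of i j w] rng i2 by auto
    moreover have "\<beta> i j \<le> \<omega> i / 2" "- (\<omega> i / 2) \<le> \<beta> j i"
      using \<beta>_le[of i j] \<beta>_ge[of j i] rng i2 by auto
    ultimately have "\<bar>U j w - \<theta>\<bar> \<le> 6 * \<omega> i + max \<bar>Z j i w\<bar> \<bar>Z i j w\<bar>"
      unfolding pass_def by (simp add: abs_if max_def split: if_splits)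
    then have "(U j w - \<theta>)\<^sup>2 \<le> (6 * \<omega> i + max \<bar>Z j i w\<bar> \<bar>Z i j w\<bar>)\<^sup>2"
      by (metis abs_ge_zero power2_abs power_mono)
    also have "\<dots> \<le> 2 * (6 * \<omega> i)\<^sup>2 + 2 * (max \<bar>Z j i w\<bar> \<bar>Z i j w\<bar>)\<^sup>2"
      using sum_squares_bound[of "6 * \<omega> i" "max \<bar>Z j i w\<bar> \<bar>Z i j w\<bar>"] by (simp add: power2_sum)
    also have "\<dots> \<le> 72 * (\<omega> i)\<^sup>2 + 2 * ((Z j i w)\<^sup>2 + (Z i j w)\<^sup>2)"
      by (auto simp: max_def power_mult_distrib)
    also have "(Z j i w)\<^sup>2 + (Z i j w)\<^sup>2 \<le> (\<Sum>j\<in>{1..<i}. (Z j i w)\<^sup>2 + (Z i j w)\<^sup>2)"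
      by (rule member_le_sum) (use less j in auto)
    finally show ?thesis unfolding bound_def if_P[OF i2] using nn zero_le_power2[of "U i w - \<theta>"] by linarith
  next
    case equal
    then show ?thesis unfolding bound_def using nn nn2 by simp
  next
    case greater
    then have "1 \<le> j - 1" "j - 1 < j" using i by auto
    \<comment> \<open>Only the failure of the immediate predecessor is used: \<open>j - 1\<close> is
      at least \<open>i\<close>, so its class contains \<open>f\<close>, and the failing index
      \<open>m\<close> is at least \<open>j\<close>.\<close>
    then obtain m where m: "j - 1 < m" "m \<le> k" "\<not> pass (j - 1) m w" using fail by blast
    then have jm: "j \<le> m" by simp
    have "(U j w - \<theta>)\<^sup>2 \<le> dev j m w * (U j w - \<theta>)\<^sup>2"
      using mult_right_mono[OF not_pass_dev[OF greater jm m(2,3)], of "(U j w - \<theta>)\<^sup>2"] by simp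
    also have "\<dots> \<le> (\<Sum>m\<in>{j..k}. dev j m w * (U j w - \<theta>)\<^sup>2)"
      by (rule member_le_sum[of m]) (use jm m dev_nonneg in auto)
    also have "\<dots> \<le> (\<Sum>j\<in>{i<..k}. \<Sum>m\<in>{j..k}. dev j m w * (U j w - \<theta>)\<^sup>2)"
      by (rule member_le_sum[of j]) (use greater j dev_nonneg in \<open>auto intro!: sum_nonneg\<close>)
    finally show ?thesis unfolding bound_def using nn2 zero_le_power2[of "U i w - \<theta>"] by linarith
  qed
qed

text \<open>
  The threshold 11/2 leaves deviations \<open>9/4 * \<omega> m\<close>, of probability at most
  \<open>2 * exp (- 81/32 * L)\<close>. After the square root lost to Cauchy-Schwarz this still beats
  the ratio \<open>(\<omega> j / \<tau>)\<^sup>2\<close>, which may be as large as \<open>exp L\<close>.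
\<close>

lemma Z_tail:
  assumes "a \<in> {1..k}" "b \<in> {1..k}" "2 \<le> max a b" "max a b \<le> m" "m \<le> k"
  shows "mean_le M (\<lambda>w. of_bool (9/4 * \<omega> m \<le> \<bar>Z a b w\<bar>)) ((2 * exp (- 5/4 * L))\<^sup>2)"
proof -
  have w: "0 < \<omega> m" using \<omega>_pos assms by simp
  have "\<omega> (max a b) \<le> \<omega> m" "0 < \<omega> (max a b)" using \<omega>_mono[of "max a b" m] \<omega>_pos[of "max a b"] assms by auto
  then have "(\<omega> (max a b))\<^sup>2 / L \<le> (\<omega> m)\<^sup>2 / L"
    using L by (intro divide_right_mono power_mono) auto
  then have "subgaussian M (Z a b) ((\<omega> m)\<^sup>2 / L)"
    using Z[of a b] assms by (auto intro: subgaussian_mono)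
  then have t: "mean_le M (\<lambda>w. of_bool (9/4 * \<omega> m \<le> \<bar>Z a b w\<bar>))
      (2 * exp (- (9/4 * \<omega> m)\<^sup>2 / (2 * ((\<omega> m)\<^sup>2 / L))))"
    by (rule subgaussian_tail) (use w L in auto)
  show ?thesis
  proof (rule mean_le_weaken[OF t])
    have e: "- (9/4 * \<omega> m)\<^sup>2 / (2 * ((\<omega> m)\<^sup>2 / L)) = - (81/32) * L"
      using w L by (simp add: field_simps power2_eq_square)
    have "exp (- (81/32) * L) \<le> exp (2 * (- 5/4 * L))" using L by simp
    also have "\<dots> = (exp (- 5/4 * L))\<^sup>2" by (simp add: power2_eq_square exp_add[symmetric])
    finally have "exp (- (81/32) * L) \<le> (exp (- 5/4 * L))\<^sup>2" .
    moreover have "(2 * exp (- 5/4 * L))\<^sup>2 = 4 * (exp (- 5/4 * L))\<^sup>2"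
      by (simp add: power_mult_distrib)
    ultimately show "2 * exp (- (9/4 * \<omega> m)\<^sup>2 / (2 * ((\<omega> m)\<^sup>2 / L))) \<le> (2 * exp (- 5/4 * L))\<^sup>2"
      unfolding e using zero_le_power2[of "exp (- 5/4 * L)"] by linarith
  qed
qed

text \<open>The proxy is relaxed from \<open>(\<omega> j)\<^sup>2 / L\<close> to
  \<open>(\<omega> j)\<^sup>2\<close>, so that bias and error share one scale.\<close>

lemma U_fourth:
  assumes "i \<le> j" "j \<le> k" "2 \<le> j"
  shows "mean_le M (\<lambda>w. (U j w - \<theta>)^4) ((100 * (\<omega> j)\<^sup>2)\<^sup>2)" "U j \<in> borel_measurable M"
proof -
  have eq: "U j w = \<theta> + \<beta> j j + Z j j w" for w
    using U[of j] Y[of j j w] assms by auto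
  have Zj: "subgaussian M (Z j j) ((\<omega> j)\<^sup>2 / L)" using Z[of j j] assms by auto
  have "(\<omega> j)\<^sup>2 / L \<le> (\<omega> j)\<^sup>2" using L by (simp add: divide_le_eq mult_le_cancel_left1)
  then have Z': "subgaussian M (Z j j) ((\<omega> j)\<^sup>2)" using Zj by (rule subgaussian_mono[rotated])
  have "\<bar>\<beta> j j\<bar> \<le> \<omega> j" using \<beta>_le[of j j] \<beta>_ge[of j j] \<omega>_pos[of j] assms by auto
  then show "mean_le M (\<lambda>w. (U j w - \<theta>)^4) ((100 * (\<omega> j)\<^sup>2)\<^sup>2)"
    using shifted_fourth_moment[OF Z', of "\<beta> j j"] \<omega>_pos[of j] assms by (simp add: eq)
  have [measurable]: "Z j j \<in> borel_measurable M" using Zj by (rule subgaussianD)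
  show "U j \<in> borel_measurable M" unfolding eq[abs_def] by measurable
qed

lemma U_second:
  assumes "2 \<le> i"
  shows "mean_le M (\<lambda>w. (U i w - \<theta>)\<^sup>2) (2051 * \<tau>\<^sup>2)"
proof (rule mean_le_mono)
  have eq: "U i w = \<theta> + \<beta> i i + Z i i w" for w
    using U[of i] Y[of i i w] assms i by auto
  have Zj: "subgaussian M (Z i i) ((\<omega> i)\<^sup>2 / L)" using Z[of i i] assms i by auto
  have "(\<omega> i)\<^sup>2 / L \<le> (\<omega> i)\<^sup>2" using L by (simp add: divide_le_eq mult_le_cancel_left1)
  then have Z': "subgaussian M (Z i i) (\<tau>\<^sup>2)" using Zj \<tau>(2)[OF assms] by (metis subgaussian_mono)
  have b: "\<bar>\<beta> i i\<bar> \<le> \<omega> i / 2" using \<beta>_le[of i i] \<beta>_ge[of i i] \<omega>_pos[of i] assms i by auto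
  show "mean_le M (\<lambda>w. 2 * (\<beta> i i)\<^sup>2 + 2 * (Z i i w)\<^sup>2) (2 * (\<beta> i i)\<^sup>2 + 2 * (1025 * \<tau>\<^sup>2))"
    using Z' \<tau>(1) by (intro mean_le_add mean_le_const mean_le_cmult subgaussian_second_moment) auto
  show "(U i w - \<theta>)\<^sup>2 \<le> 2 * (\<beta> i i)\<^sup>2 + 2 * (Z i i w)\<^sup>2" for w
    using sum_squares_bound[of "\<beta> i i" "Z i i w"] by (simp add: eq power2_sum)
  have "(\<beta> i i)\<^sup>2 \<le> (\<omega> i)\<^sup>2 / 4" using power_mono[OF b, of 2] by (simp add: power_divide)
  then show "2 * (\<beta> i i)\<^sup>2 + 2 * (1025 * \<tau>\<^sup>2) \<le> 2051 * \<tau>\<^sup>2"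
    using zero_le_power2[of "\<omega> i"] unfolding \<tau>(2)[OF assms] by linarith
  show "(\<lambda>w. (U i w - \<theta>)\<^sup>2) \<in> borel_measurable M"
    using U_fourth(2)[of i] i assms by measurable
qed simp

text \<open>Each of three deviations is paired with the fourth moment of \<open>U j\<close>. The
  quantity \<open>q\<close> multiplies the tail root \<open>2 * exp (- 5/4 * L)\<close> by the
  moment root \<open>100 * (\<omega> j)\<^sup>2\<close>, so three of them give 600. In the Markov
  term, 10000 is the product of two such moment factors 100.\<close>

lemma dev_term:
  assumes "i < j" "j \<le> m" "m \<le> k"
  shows "mean_le M (\<lambda>w. dev j m w * (U j w - \<theta>)\<^sup>2)
    (600 * K * exp (- L / 4) * \<tau>\<^sup>2 + (if j = 2 then 10000 * \<tau>\<^sup>2 * (1/4)^(m - 2) else 0))"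
proof -
  define q where "q = 2 * exp (- 5/4 * L) * (100 * (\<omega> j)\<^sup>2)"
  have j: "2 \<le> j" "j \<le> k" "i \<le> j" using assms i by auto
  note [measurable] = U_fourth(2)[OF j(3,2,1)]
  have wj: "0 < \<omega> j" using \<omega>_pos j by simp
  have Ut: "mean_le M (\<lambda>w. of_bool (9/4 * \<omega> m \<le> \<bar>Z a b w\<bar>) * (U j w - \<theta>)\<^sup>2) q"
    if "a \<in> {1..k}" "b \<in> {1..k}" "2 \<le> max a b" "max a b \<le> m" for a b
    unfolding q_def
    by (rule mean_le_times_square[OF Z_tail U_fourth(1)]) (use that assms j wj in auto)
  have q: "3 * q \<le> 600 * K * exp (- L / 4) * \<tau>\<^sup>2"
  proof -
    have "exp (- 5/4 * L) * (\<omega> j)\<^sup>2 \<le> exp (- 5/4 * L) * (K * exp L * \<tau>\<^sup>2)"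
      using \<omega>_le[of j] j by (intro mult_left_mono) auto
    also have "\<dots> = K * (exp (- 5/4 * L) * exp L) * \<tau>\<^sup>2" by simp
    also have "exp (- 5/4 * L) * exp L = exp (- L / 4)" by (simp add: exp_add[symmetric])
    finally show ?thesis by (simp add: q_def)
  qed
  have q0: "0 \<le> q" by (simp add: q_def)
  have t2: "mean_le M (\<lambda>w. of_bool (9/4 * \<omega> m \<le> \<bar>Z (j - 1) m w\<bar>) * (U j w - \<theta>)\<^sup>2) q"
    and t3: "mean_le M (\<lambda>w. of_bool (9/4 * \<omega> m \<le> \<bar>Z m (j - 1) w\<bar>) * (U j w - \<theta>)\<^sup>2) q"
    by (rule Ut; use assms i in auto)+
  define x where "x = (if j = 2 then 10000 * \<tau>\<^sup>2 * (1/4)^(m - 2) else 0)"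
  have t1: "mean_le M (\<lambda>w. (if j = 2 then far (\<omega> m) (U 1 w - \<theta>) else far (9/4 * \<omega> m) (Z (j - 1) (j - 1) w))
      * (U j w - \<theta>)\<^sup>2) (q + x)"
  proof (cases "j = 2")
    case True
    then have i1: "i = 1" using assms i by simp
    note [measurable] = first(2)[OF i1]
    have wm: "0 < \<omega> m" using \<omega>_pos assms j by simp
    have geo: "2^(m - 2) * \<omega> 2 \<le> \<omega> m"
      by (rule doubling_geometric[of k]) (use \<omega>_double True assms in auto)
    have "mean_le M (\<lambda>w. of_bool (\<omega> m \<le> \<bar>U 1 w - \<theta>\<bar>)) ((100 * \<tau>\<^sup>2)\<^sup>2 / (\<omega> m)^4)"
      by (rule mean_le_markov4[OF first(3)[OF i1] _ wm]) measurable
    moreover have "(100 * \<tau>\<^sup>2)\<^sup>2 / (\<omega> m)^4 = (100 * \<tau>\<^sup>2 / (\<omega> m)\<^sup>2)\<^sup>2"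
      by (simp add: power_divide)
    ultimately have markov: "mean_le M (\<lambda>w. of_bool (\<omega> m \<le> \<bar>U 1 w - \<theta>\<bar>) * (U j w - \<theta>)\<^sup>2)
        (100 * \<tau>\<^sup>2 / (\<omega> m)\<^sup>2 * (100 * (\<omega> j)\<^sup>2))"
      using \<tau>(1) wm wj by (intro mean_le_times_square U_fourth j) auto
    have le: "100 * \<tau>\<^sup>2 / (\<omega> m)\<^sup>2 * (100 * (\<omega> j)\<^sup>2) \<le> q + x"
    proof -
      have w2: "0 < \<omega> 2" using wj True by simp
      have "(\<omega> 2)\<^sup>2 / (\<omega> m)\<^sup>2 = (\<omega> 2 / \<omega> m)\<^sup>2" by (simp add: power_divide)
      also have "\<dots> \<le> ((1/2)^(m - 2))\<^sup>2"
        using geo w2 wm by (intro power_mono) (auto simp: field_simps)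
      also have "\<dots> = (1/4)^(m - 2)"
        by (simp add: power2_eq_square power_mult_distrib[symmetric])
      finally have "10000 * \<tau>\<^sup>2 * ((\<omega> 2)\<^sup>2 / (\<omega> m)\<^sup>2) \<le> 10000 * \<tau>\<^sup>2 * (1/4)^(m - 2)"
        by (intro mult_left_mono) auto
      then show ?thesis using q0 True by (simp add: x_def)
    qed
    show ?thesis
      using True mean_le_weaken[OF markov le] by (simp add: far_def)
  next
    case False
    then have "mean_le M (\<lambda>w. of_bool (9/4 * \<omega> m \<le> \<bar>Z (j - 1) (j - 1) w\<bar>) * (U j w - \<theta>)\<^sup>2) q"
      using assms i by (intro Ut) auto
    then show ?thesis
      using False by (simp add: x_def far_def)
  qed
  have "mean_le M (\<lambda>w. dev j m w * (U j w - \<theta>)\<^sup>2) ((q + x) + q + q)"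
    unfolding dev_def distrib_right
    by (intro mean_le_add t1) (use t2 t3 in \<open>simp_all add: far_def\<close>)
  then show ?thesis
    by (rule mean_le_weaken) (use q in \<open>simp add: x_def\<close>)
qed

text \<open>Squared errors for at most \<open>C0 * L\<close> indices have proxy
  \<open>(\<omega> i)\<^sup>2 / L\<close> and sum to order \<open>C0 * \<tau>\<^sup>2\<close>. The
  number of deviation terms is of order \<open>L\<^sup>2\<close>, which \<open>exp (- L / 4)\<close>
  absorbs, and the Markov terms form a geometric series. Finally 72 + 2051 + 20000 < 30000.\<close>

lemma mean_bound: "mean_le M bound ((30000 + 4100 * C0 + 600 * K * C0\<^sup>2) * \<tau>\<^sup>2)"
proof -
  have C0: "0 \<le> C0" using k_le i L by (smt (verit) mult_nonneg_nonneg mult_neg_pos of_nat_0_le_iff of_nat_mono of_nat_1)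
  define A where "A w = (if 2 \<le> i then 72 * (\<omega> i)\<^sup>2 + 2 * (\<Sum>j\<in>{1..<i}. (Z j i w)\<^sup>2 + (Z i j w)\<^sup>2) else 0)" for w
  have A: "mean_le M A ((72 + 4100 * C0) * \<tau>\<^sup>2)"
  proof (cases "2 \<le> i")
    case True
    define v where "v = (\<omega> i)\<^sup>2 / L"
    have v: "0 < v" using \<omega>_pos[of i] i L by (simp add: v_def)
    have term_le: "mean_le M (\<lambda>w. (Z j i w)\<^sup>2 + (Z i j w)\<^sup>2) (1025 * v + 1025 * v)" if "j \<in> {1..<i}" for j
    proof -
      have "subgaussian M (Z j i) v" "subgaussian M (Z i j) v"
        using Z[of j i] Z[of i j] that i True by (auto simp: v_def max_def)
      then show ?thesis using v by (intro mean_le_add subgaussian_second_moment) auto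
    qed
    have "mean_le M (\<lambda>w. 72 * (\<omega> i)\<^sup>2 + 2 * (\<Sum>j\<in>{1..<i}. (Z j i w)\<^sup>2 + (Z i j w)\<^sup>2))
        (72 * (\<omega> i)\<^sup>2 + 2 * (\<Sum>j\<in>{1..<i}. 1025 * v + 1025 * v))"
      by (intro mean_le_add mean_le_const mean_le_cmult mean_le_sum term_le) auto
    moreover have "72 * (\<omega> i)\<^sup>2 + 2 * (\<Sum>j\<in>{1..<i}. 1025 * v + 1025 * v) \<le> (72 + 4100 * C0) * \<tau>\<^sup>2"
    proof -
      have "real (i - 1) * v \<le> C0 * L * v"
        using k_le i v by (intro mult_right_mono) auto
      also have "\<dots> = C0 * \<tau>\<^sup>2" using L \<tau>(2)[OF True] by (simp add: v_def)
      finally show ?thesis using \<tau>(2)[OF True] by (simp add: algebra_simps)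
    qed
    ultimately show ?thesis
      unfolding A_def using True by (auto intro: mean_le_weaken)
  next
    case False
    then show ?thesis unfolding A_def using C0 by (simp add: mean_le_def)
  qed
  have B: "mean_le M (\<lambda>w. (U i w - \<theta>)\<^sup>2) (2051 * \<tau>\<^sup>2)"
  proof (cases "2 \<le> i")
    case False
    then have "i = 1" using i by simp
    then show ?thesis using first(1) by (auto intro: mean_le_weaken)
  qed (rule U_second)
  define g where "g = 600 * K * exp (- L / 4) * \<tau>\<^sup>2"
  define x where "x j m = (if j = 2 then 10000 * \<tau>\<^sup>2 * (1/4)^(m - 2) else 0)" for j m :: nat
  have D: "mean_le M (\<lambda>w. \<Sum>j\<in>{i<..k}. \<Sum>m\<in>{j..k}. dev j m w * (U j w - \<theta>)\<^sup>2)
      (\<Sum>j\<in>{i<..k}. \<Sum>m\<in>{j..k}. g + x j m)"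
    unfolding g_def x_def by (intro mean_le_sum dev_term) auto
  have g0: "0 \<le> g" using K by (simp add: g_def)
  have "(\<Sum>m\<in>{j..k}. g) \<le> real k * g" if "j \<in> {i<..k}" for j
  proof -
    have "real (card {j..k}) \<le> real k" using that by simp
    then show ?thesis using g0 by (simp only: sum_constant mult_right_mono)
  qed
  then have "(\<Sum>j\<in>{i<..k}. \<Sum>m\<in>{j..k}. g) \<le> real (card {i<..k}) * (real k * g)"
    by (rule sum_bounded_above)
  also have "\<dots> \<le> real k * (real k * g)"
    using g0 by (intro mult_right_mono) auto
  also have "\<dots> = (real k)\<^sup>2 * g" by (simp add: power2_eq_square)
  also have "\<dots> \<le> (C0 * L)\<^sup>2 * g" using k_le g0 by (intro mult_right_mono power_mono) auto
  also have "\<dots> = 600 * K * C0\<^sup>2 * \<tau>\<^sup>2 * (L\<^sup>2 * exp (- L / 4))"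
    by (simp add: g_def power_mult_distrib)
  also have "\<dots> \<le> 600 * K * C0\<^sup>2 * \<tau>\<^sup>2 * 1"
    using L_le K by (intro mult_left_mono) (auto simp: exp_minus field_simps)
  finally have s1: "(\<Sum>j\<in>{i<..k}. \<Sum>m\<in>{j..k}. g) \<le> 600 * K * C0\<^sup>2 * \<tau>\<^sup>2" by simp
  have "(\<Sum>j\<in>{i<..k}. \<Sum>m\<in>{j..k}. x j m) \<le> (\<Sum>j\<in>{i<..k}. if j = 2 then 20000 * \<tau>\<^sup>2 else 0)"
  proof (rule sum_mono)
    fix j assume "j \<in> {i<..k}"
    have "(\<Sum>m\<in>{2..k}. (1/4::real)^(m - 2)) \<le> 2"
    proof -
      \<comment> \<open>The subtracted remainder strengthens the plain bound 2 so that the induction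
        closes.\<close>
      have *: "(\<Sum>m\<in>{2..k}. (1/4::real)^(m - 2)) \<le> 2 - 8 * (1/4)^k" if "2 \<le> k" for k :: nat
        using that
      proof (induction k rule: dec_induct)
        case (step p)
        have "Suc p = Suc p - 2 + 2" using step by simp
        then have "(1/4::real)^(Suc p) = (1/4)^(Suc p - 2) * (1/4)^2"
          by (metis power_add)
        then have "(1/4::real)^(Suc p - 2) = 16 * (1/4)^(Suc p)"
          by (simp only: power2_eq_square)
        then have "(\<Sum>m\<in>{2..Suc p}. (1/4::real)^(m - 2)) = (\<Sum>m\<in>{2..p}. (1/4)^(m - 2)) + 4 * (1/4)^p"
          using step by simp
        moreover have "(1/4::real)^(Suc p) = (1/4)^p / 4" "0 \<le> (1/4::real)^p" by simp_all
        ultimately show ?case using step.IH by linarith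
      qed (simp add: power2_eq_square)
      show ?thesis
      proof (cases "2 \<le> k")
        case True
        have "0 \<le> (1/4::real)^k" by simp
        then show ?thesis using *[OF True] by linarith
      qed simp
    qed
    from mult_left_mono[OF this, of "10000 * \<tau>\<^sup>2"]
    show "(\<Sum>m\<in>{j..k}. x j m) \<le> (if j = 2 then 20000 * \<tau>\<^sup>2 else 0)"
      by (auto simp: x_def sum_distrib_left)
  qed
  also have "\<dots> \<le> 20000 * \<tau>\<^sup>2" by simp
  finally have s2: "(\<Sum>j\<in>{i<..k}. \<Sum>m\<in>{j..k}. x j m) \<le> 20000 * \<tau>\<^sup>2" .
  have "mean_le M (\<lambda>w. A w + (U i w - \<theta>)\<^sup>2 + (\<Sum>j\<in>{i<..k}. \<Sum>m\<in>{j..k}. dev j m w * (U j w - \<theta>)\<^sup>2))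
     ((72 + 4100 * C0) * \<tau>\<^sup>2 + 2051 * \<tau>\<^sup>2 + (\<Sum>j\<in>{i<..k}. \<Sum>m\<in>{j..k}. g + x j m))"
    by (intro mean_le_add A B D)
  moreover have "(72 + 4100 * C0) * \<tau>\<^sup>2 + 2051 * \<tau>\<^sup>2 + (\<Sum>j\<in>{i<..k}. \<Sum>m\<in>{j..k}. g + x j m)
      \<le> (30000 + 4100 * C0 + 600 * K * C0\<^sup>2) * \<tau>\<^sup>2"
    unfolding sum.distrib distrib_right using s1 s2 zero_le_power2[of \<tau>] by linarith
  ultimately show ?thesis
    unfolding bound_def[abs_def] A_def by (auto intro: mean_le_weaken)
qed

end

section \<open>Moduli and bias bounds\<close>

lemma l2norm_cmult: "l2norm (\<lambda>t. c * h t) = \<bar>c\<bar> * l2norm h"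
  by (simp add: l2norm_def power_mult_distrib real_sqrt_mult)

lemma modulus_mono:
  assumes "\<epsilon> \<le> \<epsilon>'" "F \<subseteq> F'" "H \<subseteq> H'"
  shows "modulus T \<epsilon> F H \<le> modulus T \<epsilon>' F' H'"
  unfolding modulus_def using assms by (intro Sup_subset_mono) force

lemma modulus_upper:
  assumes "f \<in> F" "g \<in> H" "l2norm (\<lambda>t. g t - f t) \<le> \<epsilon>"
  shows "ereal (T g - T f) \<le> modulus T \<epsilon> F H"
  unfolding modulus_def using assms by (intro Sup_upper) blast

lemma modulus_nonneg:
  assumes "h \<in> F" "h \<in> H" "0 \<le> \<epsilon>"
  shows "0 \<le> modulus T \<epsilon> F H"
  using modulus_upper[of h F h H \<epsilon> T] assms by (simp add: l2norm_def zero_ereal_def)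

text \<open>The segment from \<open>f\<close> to \<open>g\<close> is contracted by
  \<open>\<epsilon>' / \<epsilon>\<close> towards its end in the smaller class. That end is kept,
  and the moved end stays in the larger class by convexity; linearity scales the gap of
  \<open>T\<close> by the same factor.\<close>

lemma modulus_scale:
  assumes "convex_class F" "convex_class H" "linear_functional_on D T" "F \<subseteq> D" "H \<subseteq> D"
    and "F \<subseteq> H \<or> H \<subseteq> F" and "0 < \<epsilon>'" "\<epsilon>' \<le> \<epsilon>"
  shows "modulus T \<epsilon> F H \<le> ereal (\<epsilon> / \<epsilon>') * modulus T \<epsilon>' F H"
  unfolding modulus_def[of T \<epsilon>]
proof (rule Sup_least, clarify)
  fix f g assume fg: "l2norm (\<lambda>t. g t - f t) \<le> \<epsilon>" "f \<in> F" "g \<in> H"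
  define u where "u = \<epsilon>' / \<epsilon>"
  have u: "0 < u" "u \<le> 1" "u * \<epsilon> = \<epsilon>'" using assms by (auto simp: u_def)
  have norm: "l2norm (\<lambda>t. u * (g t - f t)) \<le> \<epsilon>'"
    using mult_left_mono[OF fg(1), of u] u by (simp add: l2norm_cmult)
  have conv: "(\<lambda>t. (1 - u) * p t + u * q t) \<in> G" if "convex_class G" "p \<in> G" "q \<in> G" for G p q
    using that u unfolding convex_class_def by auto
  have lin: "T (\<lambda>t. (1 - u) * p t + u * q t) = (1 - u) * T p + u * T q" if "p \<in> D" "q \<in> D" for p q
    using that assms(3) unfolding linear_functional_on_def by blast
  have D: "f \<in> D" "g \<in> D" using fg assms by auto
  have "ereal (u * (T g - T f)) \<le> modulus T \<epsilon>' F H"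
    using assms(6)
  proof
    assume "F \<subseteq> H"
    then have "ereal (T (\<lambda>t. (1 - u) * f t + u * g t) - T f) \<le> modulus T \<epsilon>' F H"
      using fg assms norm by (intro modulus_upper conv) (auto simp: algebra_simps)
    then show ?thesis by (simp only: lin[OF D]) (simp add: algebra_simps)
  next
    assume "H \<subseteq> F"
    then have "ereal (T g - T (\<lambda>t. (1 - u) * g t + u * f t)) \<le> modulus T \<epsilon>' F H"
      using fg assms norm by (intro modulus_upper conv) (auto simp: algebra_simps)
    then show ?thesis by (simp only: lin[OF D(2,1)]) (simp add: algebra_simps)
  qed
  then have "ereal (\<epsilon> / \<epsilon>') * ereal (u * (T g - T f)) \<le> ereal (\<epsilon> / \<epsilon>') * modulus T \<epsilon>' F H"
    using assms by (intro ereal_mult_left_mono) auto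
  moreover have "\<epsilon> / \<epsilon>' * (u * (T g - T f)) = T g - T f"
    using assms by (simp add: u_def)
  ultimately show "ereal (T g - T f) \<le> ereal (\<epsilon> / \<epsilon>') * modulus T \<epsilon>' F H" by simp
qed

text \<open>With this variance the subtracted line takes the value \<open>m\<close> at
  \<open>logrt n\<close>. To the left the modulus is at most \<open>m\<close> by monotonicity; to
  the right \<open>modulus_scale\<close> puts it below the line.\<close>

lemma bias_bound_le:
  assumes "convex_class F" "convex_class H" "linear_functional_on D T" "F \<subseteq> D" "H \<subseteq> D"
    and "F \<subseteq> H \<or> H \<subseteq> F" and n: "1 < n"
    and m: "modulus T (logrt n) F H = ereal m" "0 \<le> m"
  shows "bias_bound T n F H (m\<^sup>2 / ln (real n)) \<le> ereal (m / 2)"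
proof -
  have ln0: "0 < ln (real n)" using n by simp
  then have e0: "0 < logrt n" using n by (simp add: logrt_def)
  have slope: "sqrt (real n * (m\<^sup>2 / ln (real n))) = m / logrt n"
    using m(2) ln0 n by (simp add: logrt_def real_sqrt_mult real_sqrt_divide)
  have "modulus T \<epsilon> F H - ereal (m / logrt n * \<epsilon>) \<le> ereal m" if "0 < \<epsilon>" for \<epsilon>
  proof (cases "\<epsilon> \<le> logrt n")
    case True
    then have "modulus T \<epsilon> F H \<le> ereal m" using modulus_mono[of \<epsilon> "logrt n" F F H H T] m by simp
    moreover have "0 \<le> m / logrt n * \<epsilon>" using m(2) e0 that by simp
    ultimately show ?thesis
      by (cases "modulus T \<epsilon> F H") auto
  next
    case False
    then have "modulus T \<epsilon> F H \<le> ereal (\<epsilon> / logrt n) * modulus T (logrt n) F H"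
      using e0 assms by (intro modulus_scale[where D = D]) auto
    then have "modulus T \<epsilon> F H \<le> ereal (m / logrt n * \<epsilon>)" by (simp add: m(1) mult.commute)
    then show ?thesis using m(2) by (cases "modulus T \<epsilon> F H") auto
  qed
  then have "(SUP \<epsilon>\<in>{0<..}. modulus T \<epsilon> F H - ereal (m / logrt n * \<epsilon>)) \<le> ereal m"
    by (intro SUP_least) auto
  then have "ereal (1/2) * (SUP \<epsilon>\<in>{0<..}. modulus T \<epsilon> F H - ereal (m / logrt n * \<epsilon>)) \<le> ereal (1/2) * ereal m"
    by (intro ereal_mult_left_mono) auto
  then show ?thesis unfolding bias_bound_def slope by simp
qed

lemma pair_estimator_bounds:
  assumes "convex_class F" "convex_class H" "linear_functional_on D T" "F \<subseteq> D" "H \<subseteq> D"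
    and "F \<subseteq> H \<or> H \<subseteq> F" and n: "1 < n"
    and m: "modulus T (logrt n) F H = ereal m" "0 \<le> m"
    and S: "pair_estimator M W n T F H S"
  shows "linear_estimator M W n S"
    and "f \<in> L2 \<Longrightarrow> prob_space.variance M (S f) \<le> m\<^sup>2 / ln (real n)"
    and "f \<in> F \<Longrightarrow> bias M T S f \<le> m / 2"
    and "f \<in> H \<Longrightarrow> - (m / 2) \<le> bias M T S f"
proof -
  have rm: "rmodulus T (logrt n) F H = m" by (simp add: rmodulus_def m)
  note S' = S[unfolded pair_estimator_def Let_def rm]
  show "linear_estimator M W n S" "f \<in> L2 \<Longrightarrow> prob_space.variance M (S f) \<le> m\<^sup>2 / ln (real n)"
    using S' by auto
  have bb: "bias_bound T n F H (m\<^sup>2 / ln (real n)) \<le> ereal (m / 2)"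
    using assms by (intro bias_bound_le[where D = D]) auto
  have up: "(SUP f\<in>F. ereal (bias M T S f)) \<le> ereal (m / 2)" using S' bb by auto
  have "- ereal (m / 2) \<le> - bias_bound T n F H (m\<^sup>2 / ln (real n))"
    using bb by (simp only: ereal_minus_le_minus)
  then have lo: "- ereal (m / 2) \<le> (INF f\<in>H. ereal (bias M T S f))" using S' by auto
  show "bias M T S f \<le> m / 2" if "f \<in> F"
  proof -
    have "ereal (bias M T S f) \<le> ereal (m / 2)" using order_trans[OF SUP_upper[OF that] up] .
    then show ?thesis by simp
  qed
  show "- (m / 2) \<le> bias M T S f" if "f \<in> H"
  proof -
    have "- ereal (m / 2) \<le> ereal (bias M T S f)" using order_trans[OF lo INF_lower[OF that]] .
    then show ?thesis by simp
  qed
qed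

text \<open>Risk is variance plus squared bias, so a bound on the risk bounds both; these feed
  \<open>shifted_fourth_moment\<close>.\<close>

lemma base_estimator_bounds:
  assumes B: "brownian_motion M W" and n: "0 < n" and S: "base_estimator M W n T F S"
    and f: "f \<in> F" "f \<in> L2" and s: "0 \<le> s" "rmodulus T (1 / sqrt (real n)) F F = s"
  shows "(\<integral>\<^sup>+ w. ennreal ((S f w - T f)\<^sup>2) \<partial>M) \<le> ennreal (s\<^sup>2)"
    and "prob_space.variance M (S f) \<le> s\<^sup>2" and "\<bar>bias M T S f\<bar> \<le> s"
proof -
  interpret prob_space M using B by (simp add: brownian_motion_def)
  have lin: "linear_estimator M W n S" using S by (simp add: base_estimator_def)
  note [measurable] = linear_estimator_subgaussian(1)[OF B n lin f(2)]
  note sq = linear_estimator_subgaussian(2)[OF B n lin f(2)]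
  have int: "integrable M (S f)" by (rule square_integrable_imp_integrable[OF _ sq]) measurable
  have "(\<integral>\<^sup>+ w. ennreal ((S f w - T f)\<^sup>2) \<partial>M) \<le> sup_risk M T F S"
    unfolding sup_risk_def using f(1) by (rule SUP_upper)
  also have "\<dots> \<le> ennreal (s\<^sup>2)" using S s by (simp add: base_estimator_def)
  finally show le: "(\<integral>\<^sup>+ w. ennreal ((S f w - T f)\<^sup>2) \<partial>M) \<le> ennreal (s\<^sup>2)" .
  have eq: "(S f w - T f)\<^sup>2 = (S f w)\<^sup>2 - 2 * T f * S f w + (T f)\<^sup>2" for w
    by (simp add: power2_diff)
  have int2: "integrable M (\<lambda>w. (S f w - T f)\<^sup>2)" unfolding eq using sq int by simp
  have "expectation (\<lambda>w. (S f w - T f)\<^sup>2) = expectation (\<lambda>w. (S f w)\<^sup>2) - 2 * T f * expectation (S f) + (T f)\<^sup>2"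
    unfolding eq using sq int by (simp add: prob_space)
  also have "\<dots> = variance (S f) + (bias M T S f)\<^sup>2"
    using variance_eq[OF int sq] by (simp add: power2_diff)
  finally have "ennreal (variance (S f) + (bias M T S f)\<^sup>2) \<le> ennreal (s\<^sup>2)"
    using le nn_integral_eq_integral[OF int2] by simp
  then have tot: "variance (S f) + (bias M T S f)\<^sup>2 \<le> s\<^sup>2"
    by (subst (asm) ennreal_le_iff) auto
  show "variance (S f) \<le> s\<^sup>2" using tot zero_le_power2[of "bias M T S f"] by linarith
  have "(bias M T S f)\<^sup>2 \<le> s\<^sup>2" using tot variance_positive[of "S f"] by linarith
  then show "\<bar>bias M T S f\<bar> \<le> s" using s(1) abs_le_square_iff[of "bias M T S f" s] by simp
qed

section \<open>Nested classes on the grid\<close>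

text \<open>Unites both branches of \<open>grid\<close>. The growth is only weak because the two
  points of the first branch coincide when the set is a singleton; doubling is vacuous
  there.\<close>

lemma grid_cases:
  assumes "grid \<Omega> k \<xi>" "Inf \<Omega> \<le> Sup \<Omega>"
  shows "1 \<le> k" "\<xi> 1 = Inf \<Omega>"
    and "\<And>j. 1 \<le> j \<Longrightarrow> Suc j \<le> k \<Longrightarrow> \<xi> j \<le> \<xi> (Suc j)"
    and "\<And>j. 2 \<le> j \<Longrightarrow> Suc j \<le> k \<Longrightarrow> 2 * \<xi> j \<le> \<xi> (Suc j)"
proof -
  have "1 \<le> k \<and> \<xi> 1 = Inf \<Omega> \<and> (\<forall>j. 1 \<le> j \<longrightarrow> Suc j \<le> k \<longrightarrow> \<xi> j \<le> \<xi> (Suc j)) \<and>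
    (\<forall>j. 2 \<le> j \<longrightarrow> Suc j \<le> k \<longrightarrow> 2 * \<xi> j \<le> \<xi> (Suc j))"
  proof (cases "\<forall>\<omega>\<in>\<Omega>. \<omega> > Inf \<Omega> \<longrightarrow> \<omega> > Sup \<Omega> / 2")
    case True
    then have g: "k = 2" "\<xi> 1 = Inf \<Omega>" "\<xi> 2 = Sup \<Omega>" using assms(1) by (simp_all add: grid_def)
    have "j = 1" if "1 \<le> j" "Suc j \<le> 2" for j :: nat using that by simp
    then show ?thesis using g assms(2) by (auto simp: numeral_2_eq_2)
  next
    case False
    then have g: "k \<ge> 1" "\<forall>i\<in>{1..<k}. \<xi> i < \<xi> (i + 1)" "\<xi> 1 = Inf \<Omega>"
      "\<forall>i. 2 \<le> i \<and> i + 1 \<le> k \<longrightarrow> \<xi> (i + 1) \<ge> 2 * \<xi> i"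
      using assms(1) unfolding grid_def if_not_P[OF False] by blast+
    then show ?thesis by (auto intro: less_imp_le)
  qed
  then show "1 \<le> k" "\<xi> 1 = Inf \<Omega>"
    and "\<And>j. 1 \<le> j \<Longrightarrow> Suc j \<le> k \<Longrightarrow> \<xi> j \<le> \<xi> (Suc j)"
    and "\<And>j. 2 \<le> j \<Longrightarrow> Suc j \<le> k \<Longrightarrow> 2 * \<xi> j \<le> \<xi> (Suc j)" by blast+
qed

text \<open>A value above the minimum exceeds the first grid point, so its covering index is at
  least 2. In the two-point branch the maximum covers it, and the branch condition gives the factor
  2.\<close>

lemma grid_covers:
  assumes "grid \<Omega> k \<xi>" "\<omega> \<in> \<Omega>" "Inf \<Omega> < \<omega>" "\<omega> \<le> Sup \<Omega>"
  obtains i where "2 \<le> i" "i \<le> k" "\<omega> \<le> \<xi> i" "\<xi> i \<le> 2 * \<omega>"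
proof (cases "\<forall>\<omega>\<in>\<Omega>. \<omega> > Inf \<Omega> \<longrightarrow> \<omega> > Sup \<Omega> / 2")
  case True
  then have "k = 2" "\<xi> 2 = Sup \<Omega>" using assms(1) by (simp_all add: grid_def)
  then show thesis using True assms by (intro that[of 2]) auto
next
  case False
  then have "\<forall>\<omega>\<in>\<Omega>. \<exists>i\<in>{1..k}. \<xi> i / 2 < \<omega> \<and> \<omega> \<le> \<xi> i" "\<xi> 1 = Inf \<Omega>"
    using assms(1) unfolding grid_def if_not_P[OF False] by blast+
  then obtain i where i: "i \<in> {1..k}" "\<xi> i / 2 < \<omega>" "\<omega> \<le> \<xi> i" "\<xi> 1 < \<omega>"
    using assms by auto
  then have "i \<noteq> 1" by auto
  then show thesis using i by (intro that[of i]) auto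
qed

text \<open>(C2) enters as positivity and finiteness of the moduli, (C3) as their strict ordering.
  Their dependence on \<open>\<epsilon>\<close> is controlled by convexity through
  \<open>modulus_scale\<close>.\<close>

locale nested_classes =
  fixes \<Lambda> :: "'l::linorder set" and lmin lmax :: 'l
    and F :: "'l \<Rightarrow> (real \<Rightarrow> real) set" and D :: "(real \<Rightarrow> real) set"
    and T :: "(real \<Rightarrow> real) \<Rightarrow> real" and \<epsilon>0 :: real
  assumes L2: "\<And>a. a \<in> \<Lambda> \<Longrightarrow> F a \<subseteq> L2" and convex: "\<And>a. a \<in> \<Lambda> \<Longrightarrow> convex_class (F a)"
    and linear: "linear_functional_on D T" and domain: "\<And>a. a \<in> \<Lambda> \<Longrightarrow> F a \<subseteq> D"
    and \<epsilon>0: "0 < \<epsilon>0" and extremes: "lmin \<in> \<Lambda>" "lmax \<in> \<Lambda>" "\<And>a. a \<in> \<Lambda> \<Longrightarrow> lmin \<le> a \<and> a \<le> lmax"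
    and nested: "\<And>a b. a \<in> \<Lambda> \<Longrightarrow> b \<in> \<Lambda> \<Longrightarrow> a > b \<Longrightarrow> F a \<subseteq> F b"
    and finite_pos: "\<And>\<epsilon> a. 0 < \<epsilon> \<Longrightarrow> \<epsilon> \<le> \<epsilon>0 \<Longrightarrow> a \<in> \<Lambda> \<Longrightarrow>
      0 < modulus T \<epsilon> (F a) (F a) \<and> modulus T \<epsilon> (F a) (F a) < \<infinity>"
    and strict: "\<And>\<epsilon> a b. 0 < \<epsilon> \<Longrightarrow> \<epsilon> \<le> \<epsilon>0 \<Longrightarrow> a \<in> \<Lambda> \<Longrightarrow> b \<in> \<Lambda> \<Longrightarrow> b < a \<Longrightarrow>
      modulus T \<epsilon> (F a) (F a) < modulus T \<epsilon> (F b) (F b)"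
begin

section \<open>Uniform size of the moduli over the family\<close>

abbreviation om :: "real \<Rightarrow> 'l \<Rightarrow> real" where "om \<epsilon> a \<equiv> rmodulus T \<epsilon> (F a) (F a)"

lemma om:
  assumes "0 < \<epsilon>" "\<epsilon> \<le> \<epsilon>0" "a \<in> \<Lambda>"
  shows "modulus T \<epsilon> (F a) (F a) = ereal (om \<epsilon> a)" "0 < om \<epsilon> a"
  using finite_pos[OF assms] unfolding rmodulus_def
  by (cases "modulus T \<epsilon> (F a) (F a)"; simp)+

lemma om_strict:
  assumes "0 < \<epsilon>" "\<epsilon> \<le> \<epsilon>0" "a \<in> \<Lambda>" "b \<in> \<Lambda>" "b < a"
  shows "om \<epsilon> a < om \<epsilon> b"
  using strict[OF assms] om[OF assms(1,2)] assms by simp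

lemma om_anti:
  assumes "0 < \<epsilon>" "\<epsilon> \<le> \<epsilon>0" "a \<in> \<Lambda>" "b \<in> \<Lambda>" "b \<le> a"
  shows "om \<epsilon> a \<le> om \<epsilon> b"
proof (cases "a = b")
  case False
  then have "b < a" using assms(5) by simp
  from om_strict[OF assms(1-4) this] show ?thesis by simp
qed simp

text \<open>Strict ordering allows comparison of moduli to be read back as comparison of parameters;
  thus increasing grid values yield nested grid classes.\<close>

lemma om_le_nested:
  assumes "0 < \<epsilon>" "\<epsilon> \<le> \<epsilon>0" "a \<in> \<Lambda>" "b \<in> \<Lambda>" "om \<epsilon> a \<le> om \<epsilon> b"
  shows "F a \<subseteq> F b"
proof -
  have "b \<le> a"
  proof (rule ccontr)
    assume "\<not> b \<le> a"
    then have "om \<epsilon> b < om \<epsilon> a" using assms by (intro om_strict) auto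
    then show False using assms by simp
  qed
  then show ?thesis using nested[of a b] assms by (cases "a = b") auto
qed

lemma om_upper:
  assumes "0 < \<epsilon>" "\<epsilon> \<le> \<epsilon>0" "a \<in> \<Lambda>"
  shows "om \<epsilon> a \<le> om \<epsilon>0 lmin"
proof -
  have "om \<epsilon> a \<le> om \<epsilon> lmin" using assms extremes by (intro om_anti) auto
  also have "ereal (om \<epsilon> lmin) \<le> ereal (om \<epsilon>0 lmin)"
    using modulus_mono[OF assms(2), of "F lmin" "F lmin" "F lmin" "F lmin" T]
      om(1)[of \<epsilon> lmin] om(1)[of \<epsilon>0 lmin] assms extremes \<epsilon>0 by simp
  then have "om \<epsilon> lmin \<le> om \<epsilon>0 lmin" by simp
  finally show ?thesis .
qed

text \<open>Scaling from \<open>\<epsilon>0\<close> down to \<open>\<epsilon>\<close> in the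
  smallest class, whose modulus is least, gives a slope independent of \<open>a\<close> and
  \<open>\<epsilon>\<close>.\<close>

lemma om_lower:
  assumes "0 < \<epsilon>" "\<epsilon> \<le> \<epsilon>0" "a \<in> \<Lambda>"
  shows "\<epsilon> * (om \<epsilon>0 lmax / \<epsilon>0) \<le> om \<epsilon> a"
proof -
  have "modulus T \<epsilon>0 (F lmax) (F lmax) \<le> ereal (\<epsilon>0 / \<epsilon>) * modulus T \<epsilon> (F lmax) (F lmax)"
    using assms extremes convex linear domain by (intro modulus_scale[where D = D]) auto
  then have "om \<epsilon>0 lmax \<le> \<epsilon>0 / \<epsilon> * om \<epsilon> lmax"
    using om(1)[of \<epsilon> lmax] om(1)[of \<epsilon>0 lmax] assms extremes \<epsilon>0 by simp
  then have "\<epsilon> * (om \<epsilon>0 lmax / \<epsilon>0) \<le> om \<epsilon> lmax"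
    using assms \<epsilon>0 by (simp add: field_simps)
  also have "\<dots> \<le> om \<epsilon> a" using assms extremes by (intro om_anti) auto
  finally show ?thesis .
qed

text \<open>Bounds the number of doublings between the lower bound of \<open>om_lower\<close> and
  the upper bound of \<open>om_upper\<close>, per unit of \<open>ln n\<close>. The 3 accounts for
  the first grid points and the factor \<open>sqrt n\<close>.\<close>

definition grid_const :: real where
  "grid_const = 3 + 2 * \<bar>ln (om \<epsilon>0 lmin / (om \<epsilon>0 lmax / \<epsilon>0))\<bar>"

definition ratio_const :: real where
  "ratio_const = (om \<epsilon>0 lmin / (om \<epsilon>0 lmax / \<epsilon>0))\<^sup>2"

definition risk_const :: real where
  "risk_const = 30000 + 4100 * grid_const + 600 * ratio_const * grid_const\<^sup>2"

lemma risk_const_pos: "0 < risk_const"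
proof -
  have "0 \<le> grid_const" "0 \<le> ratio_const" by (simp_all add: grid_const_def ratio_const_def)
  then show ?thesis unfolding risk_const_def by (intro add_pos_nonneg) auto
qed

lemma Omega_bounds:
  assumes "0 < \<epsilon>" "\<epsilon> \<le> \<epsilon>0"
  shows "Inf (om \<epsilon> ` \<Lambda>) = om \<epsilon> lmax" "Sup (om \<epsilon> ` \<Lambda>) = om \<epsilon> lmin"
proof -
  show "Inf (om \<epsilon> ` \<Lambda>) = om \<epsilon> lmax"
    using om_anti[OF assms] extremes by (intro cInf_eq_minimum) auto
  show "Sup (om \<epsilon> ` \<Lambda>) = om \<epsilon> lmin"
    using om_anti[OF assms] extremes by (intro cSup_eq_maximum) auto
qed

lemma grid_risk:
  fixes n :: nat and M :: "'w measure"
  assumes n: "1 \<le> ln (real n)" "(ln (real n))\<^sup>2 \<le> exp (ln (real n) / 4)" "logrt n \<le> \<epsilon>0"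
    and B: "brownian_motion M W" and con: "construction M W n T \<Lambda> F k \<xi> l S1 S"
    and i: "1 \<le> i" "i \<le> k" and f: "f \<in> F (l i)"
    and \<tau>: "\<tau> = (if i = 1 then om (1 / sqrt (real n)) (l 1) else om (logrt n) (l i))"
  shows "(\<integral>\<^sup>+ w. ennreal ((adaptive_estimator T n (\<lambda>i. F (l i)) k S1 S f w - T f)\<^sup>2) \<partial>M)
    \<le> ennreal (risk_const * \<tau>\<^sup>2)"
proof -
  interpret prob_space M using B by (simp add: brownian_motion_def)
  define L where "L = ln (real n)"
  \<comment> \<open>Since \<open>ln 0 = 0\<close> by convention, the assumption excludes
    \<open>n = 0\<close> as well as \<open>n = 1\<close>.\<close>
  have n1: "1 < n" using n(1) by (cases "n \<le> 1") (auto simp: le_Suc_eq)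
  have L: "1 \<le> L" "exp L = real n" using n n1 by (auto simp: L_def)
  have le_logrt: "1 / sqrt (real n) \<le> logrt n"
    using n(1) n1 unfolding logrt_def real_sqrt_divide by (intro divide_right_mono) auto
  have e1: "0 < 1 / sqrt (real n)" "1 / sqrt (real n) \<le> \<epsilon>0" using n1 le_logrt n(3) by auto
  have e0: "0 < logrt n" using e1 le_logrt by linarith
  note e = e0 n(3)
  have grid: "grid (om (logrt n) ` \<Lambda>) k \<xi>"
    and l: "\<And>j. 1 \<le> j \<Longrightarrow> j \<le> k \<Longrightarrow> l j \<in> \<Lambda>" and \<xi>: "\<And>j. 1 \<le> j \<Longrightarrow> j \<le> k \<Longrightarrow> \<xi> j = om (logrt n) (l j)"
    and base: "base_estimator M W n T (F (l 1)) S1"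
    and pair: "\<And>a b. a \<in> {1..k} \<Longrightarrow> b \<in> {1..k} \<Longrightarrow> 2 \<le> max a b \<Longrightarrow>
      pair_estimator M W n T (F (l a)) (F (l b)) (S a b)"
    using con unfolding construction_def by auto
  have Om: "Inf (om (logrt n) ` \<Lambda>) \<le> Sup (om (logrt n) ` \<Lambda>)"
    unfolding Omega_bounds[OF e] using extremes by (intro om_anti e) auto
  note g = grid_cases[OF grid Om]
  define \<omega> where "\<omega> j = om (logrt n) (l j)" for j
  have pos: "0 < \<omega> j" if "1 \<le> j" "j \<le> k" for j unfolding \<omega>_def using that by (intro om e l)
  have mono: "\<omega> j \<le> \<omega> m" if "1 \<le> j" "j \<le> m" "m \<le> k" for j m
    using that(2,3,1)
  proof (induction m rule: dec_induct)
    case (step p)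
    then have "\<omega> j \<le> \<omega> p" by simp
    also have "\<dots> \<le> \<omega> (Suc p)" using g(3)[of p] \<xi>[of p] \<xi>[of "Suc p"] step unfolding \<omega>_def by auto
    finally show ?case .
  qed simp
  have double: "2 * \<omega> j \<le> \<omega> (Suc j)" if "2 \<le> j" "Suc j \<le> k" for j
    using g(4)[of j] \<xi>[of j] \<xi>[of "Suc j"] that unfolding \<omega>_def by auto
  have sub: "F (l a) \<subseteq> F (l b)" if "1 \<le> a" "a \<le> b" "b \<le> k" for a b
    using mono[OF that] that unfolding \<omega>_def by (intro om_le_nested[OF e] l) auto
  have fL2: "f \<in> L2" using f L2 l i by blast
  have fin: "f \<in> F (l a)" if "i \<le> a" "a \<le> k" for a using sub[of i a] that i f by auto
  have n0: "0 < n" using n1 by simp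
  obtain h where h: "h \<in> F lmax"
  proof (cases "F lmax = {}")
    case True
    then have "modulus T \<epsilon>0 (F lmax) (F lmax) = -\<infinity>" by (simp add: modulus_def bot_ereal_def)
    then show thesis using finite_pos[of \<epsilon>0 lmax] \<epsilon>0 extremes by simp
  qed blast
  have hin: "h \<in> F a" if "a \<in> \<Lambda>" for a
    using h nested[of lmax a] extremes that by (cases "a = lmax") (auto simp: less_le)
  define B0 where "B0 = om \<epsilon>0 lmin"
  define b0 where "b0 = om \<epsilon>0 lmax / \<epsilon>0"
  have b0: "0 < b0" using om(2)[of \<epsilon>0 lmax] \<epsilon>0 extremes by (simp add: b0_def)
  have B0: "0 < B0" using om(2)[of \<epsilon>0 lmin] \<epsilon>0 extremes by (simp add: B0_def)
  \<comment> \<open>In both cases the target rate is at least of order \<open>1 / sqrt n\<close>;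
    hence squared moduli exceed \<open>\<tau>\<^sup>2\<close> by at most a multiple of
    \<open>n = exp L\<close>.\<close>
  have \<tau>_ge: "b0 / sqrt (real n) \<le> \<tau>"
  proof (cases "i = 1")
    case True
    then show ?thesis using om_lower[OF e1, of "l 1"] l i \<tau> by (simp add: b0_def mult.commute)
  next
    case False
    have "b0 / sqrt (real n) \<le> logrt n * b0"
      using mult_right_mono[OF le_logrt, of b0] b0 by simp
    also have "\<dots> \<le> \<tau>" using om_lower[OF e, of "l i"] l i \<tau> False by (simp add: b0_def)
    finally show ?thesis .
  qed
  have \<tau>0: "0 < \<tau>" using less_le_trans[OF _ \<tau>_ge] b0 n1 by simp
  have ratio: "(\<omega> j)\<^sup>2 \<le> ratio_const * exp L * \<tau>\<^sup>2" if "1 \<le> j" "j \<le> k" for j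
  proof -
    have "\<omega> j \<le> B0" unfolding \<omega>_def B0_def using that by (intro om_upper e l)
    also have "B0 = B0 / b0 * sqrt (real n) * (b0 / sqrt (real n))" using b0 n1 by simp
    also have "\<dots> \<le> B0 / b0 * sqrt (real n) * \<tau>"
      using \<tau>_ge B0 b0 by (intro mult_left_mono) auto
    finally have "(\<omega> j)\<^sup>2 \<le> (B0 / b0 * sqrt (real n) * \<tau>)\<^sup>2"
      using pos[OF that] by (intro power_mono) auto
    also have "\<dots> = (B0 / b0)\<^sup>2 * exp L * \<tau>\<^sup>2"
      by (simp only: power_mult_distrib L(2)) simp
    finally show ?thesis by (simp only: ratio_const_def B0_def b0_def)
  qed
  have k_le: "real k \<le> grid_const * L"
  proof (cases "k \<le> 2")
    case True
    then have "real k \<le> 3 * 1" by simp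
    also have "\<dots> \<le> grid_const * L" using L by (intro mult_mono) (auto simp: grid_const_def)
    finally show ?thesis .
  next
    case False
    then have k2: "2 \<le> k" by simp
    have geo: "2^(k - 2) * \<omega> 2 \<le> \<omega> k"
      by (rule doubling_geometric[of k]) (use double k2 in auto)
    have "b0 / sqrt (real n) \<le> logrt n * b0"
      using mult_right_mono[OF le_logrt, of b0] b0 by simp
    also have "\<dots> \<le> \<omega> 2" unfolding \<omega>_def b0_def using k2 by (intro om_lower e l) auto
    finally have "2^(k - 2) * (b0 / sqrt (real n)) \<le> 2^(k - 2) * \<omega> 2"
      by (rule mult_left_mono) simp
    also have "\<dots> \<le> \<omega> k" by (rule geo)
    also have "\<dots> \<le> B0" unfolding \<omega>_def B0_def using k2 by (intro om_upper e l) auto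
    finally have "2^(k - 2) \<le> B0 / b0 * sqrt (real n)"
      using b0 n1 by (simp add: field_simps)
    then have "ln (2^(k - 2)) \<le> ln (B0 / b0 * sqrt (real n))" by (simp add: ln_mono)
    also have "\<dots> = ln (B0 / b0) + L / 2"
      using B0 b0 n1 by (subst ln_mult) (auto simp: ln_sqrt L_def)
    also have "ln (2^(k - 2)) = real (k - 2) * ln 2" by (simp add: ln_realpow)
    finally have "real (k - 2) * ln 2 \<le> \<bar>ln (B0 / b0)\<bar> + L / 2" by simp
    moreover have "real (k - 2) * (1/2) \<le> real (k - 2) * ln 2"
      using ln2_ge_two_thirds by (intro mult_left_mono) auto
    ultimately have "real k \<le> 2 + 2 * \<bar>ln (B0 / b0)\<bar> + L" using k2 by (simp add: of_nat_diff)
    also have "\<dots> \<le> (2 + 2 * \<bar>ln (B0 / b0)\<bar>) * L + L"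
      using mult_left_mono[OF L(1), of "2 + 2 * \<bar>ln (B0 / b0)\<bar>"] by simp
    also have "\<dots> = grid_const * L" by (simp add: grid_const_def B0_def b0_def algebra_simps)
    finally show ?thesis .
  qed
  define Z where "Z a b w = S a b f w - expectation (S a b f)" for a b w
  have pairs: "subgaussian M (Z a b) ((\<omega> (max a b))\<^sup>2 / L) \<and>
      (i \<le> a \<longrightarrow> bias M T (S a b) f \<le> \<omega> (max a b) / 2) \<and>
      (i \<le> b \<longrightarrow> - (\<omega> (max a b) / 2) \<le> bias M T (S a b) f)"
    if ab: "a \<in> {1..k}" "b \<in> {1..k}" "2 \<le> max a b" for a b
  proof -
    \<comment> \<open>The class with the larger index contains both classes, so its modulus
      dominates the mixed one.\<close>
    have le: "modulus T (logrt n) (F (l a)) (F (l b)) \<le> ereal (\<omega> (max a b))"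
    proof -
      have "modulus T (logrt n) (F (l a)) (F (l b)) \<le> modulus T (logrt n) (F (l (max a b))) (F (l (max a b)))"
        using ab by (intro modulus_mono sub) auto
      also have "\<dots> = ereal (\<omega> (max a b))" unfolding \<omega>_def using ab by (intro om e l) auto
      finally show ?thesis .
    qed
    have ge: "0 \<le> modulus T (logrt n) (F (l a)) (F (l b))"
      using ab e0 by (intro modulus_nonneg[of h] hin l) auto
    obtain m where m: "modulus T (logrt n) (F (l a)) (F (l b)) = ereal m" "0 \<le> m" "m \<le> \<omega> (max a b)"
      using le ge by (cases "modulus T (logrt n) (F (l a)) (F (l b))") auto
    have nest: "F (l a) \<subseteq> F (l b) \<or> F (l b) \<subseteq> F (l a)"
      using sub[of a b] sub[of b a] ab by (cases "a \<le> b") auto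
    have la: "l a \<in> \<Lambda>" "l b \<in> \<Lambda>" using ab l by auto
    note pb = pair_estimator_bounds[OF convex[OF la(1)] convex[OF la(2)] linear domain[OF la(1)]
        domain[OF la(2)] nest n1 m(1,2) pair[OF ab]]
    have "subgaussian M (Z a b) (variance (S a b f))"
      unfolding Z_def[abs_def] by (rule linear_estimator_subgaussian(3)[OF B n0 pb(1) fL2])
    moreover have "variance (S a b f) \<le> (\<omega> (max a b))\<^sup>2 / L"
    proof -
      have "variance (S a b f) \<le> m\<^sup>2 / L" using pb(2)[OF fL2] by (simp add: L_def)
      also have "\<dots> \<le> (\<omega> (max a b))\<^sup>2 / L" using m L by (intro divide_right_mono power_mono) auto
      finally show ?thesis .
    qed
    ultimately have "subgaussian M (Z a b) ((\<omega> (max a b))\<^sup>2 / L)" by (rule subgaussian_mono)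
    moreover have "bias M T (S a b) f \<le> \<omega> (max a b) / 2" if "i \<le> a"
      using pb(3)[of f] fin[of a] that ab m by auto
    moreover have "- (\<omega> (max a b) / 2) \<le> bias M T (S a b) f" if "i \<le> b"
      using pb(4)[of f] fin[of b] that ab m by auto
    ultimately show ?thesis by blast
  qed
  have first: "mean_le M (\<lambda>w. (S1 f w - T f)\<^sup>2) (\<tau>\<^sup>2) \<and> S1 f \<in> borel_measurable M \<and>
      mean_le M (\<lambda>w. (S1 f w - T f)^4) ((100 * \<tau>\<^sup>2)\<^sup>2)" if "i = 1"
  proof -
    have lin: "linear_estimator M W n S1" using base by (simp add: base_estimator_def)
    have \<tau>1: "om (1 / sqrt (real n)) (l 1) = \<tau>" using that \<tau> by simp
    have f1: "f \<in> F (l 1)" using f that by simp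
    note bb = base_estimator_bounds[OF B n0 base f1 fL2 less_imp_le[OF \<tau>0] \<tau>1]
    note sg = linear_estimator_subgaussian[OF B n0 lin fL2]
    note [measurable] = sg(1)
    have "mean_le M (\<lambda>w. (bias M T S1 f + (S1 f w - expectation (S1 f)))^4) ((100 * \<tau>\<^sup>2)\<^sup>2)"
      by (rule shifted_fourth_moment[OF subgaussian_mono[OF sg(3) bb(2)] \<tau>0 bb(3)])
    then have "mean_le M (\<lambda>w. (S1 f w - T f)^4) ((100 * \<tau>\<^sup>2)\<^sup>2)" by simp
    then show ?thesis using bb(1) sg(1) by (auto simp: mean_le_def)
  qed
  interpret selection_bounds M "\<lambda>j. single_est S1 S j f" "\<lambda>a b. S a b f" Z
    "\<lambda>a b. bias M T (S a b) f" \<omega> k i L \<tau> "T f" ratio_const grid_const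
  proof unfold_locales
    show "L\<^sup>2 \<le> exp (L / 4)" using n(2) by (simp add: L_def)
    show "0 \<le> ratio_const" by (simp add: ratio_const_def)
  qed (use i L pos mono double pairs \<tau>0 \<tau> ratio k_le first in \<open>auto simp: single_est_def Z_def \<omega>_def\<close>)
  have "(adaptive_estimator T n (\<lambda>i. F (l i)) k S1 S f w - T f)\<^sup>2 \<le> bound w" for w
  proof -
    have p: "passes T n (\<lambda>i. F (l i)) S1 S j m f w = pass j m w" for j m
      by (simp add: passes_def pass_def \<omega>_def)
    obtain j where "1 \<le> j" "j \<le> k"
      "\<And>m. j < m \<Longrightarrow> m \<le> k \<Longrightarrow> pass j m w"
      "\<And>i. 1 \<le> i \<Longrightarrow> i < j \<Longrightarrow> \<exists>m. i < m \<and> m \<le> k \<and> \<not> pass i m w"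
      "adaptive_estimator T n (\<lambda>i. F (l i)) k S1 S f w = single_est S1 S j f w"
      using adaptive_estimator_selects[OF g(1), of T n "\<lambda>i. F (l i)" S1 S f w] unfolding p by blast
    then show ?thesis using selected_le_bound by simp
  qed
  then have "(\<integral>\<^sup>+ w. ennreal ((adaptive_estimator T n (\<lambda>i. F (l i)) k S1 S f w - T f)\<^sup>2) \<partial>M)
      \<le> (\<integral>\<^sup>+ w. ennreal (bound w) \<partial>M)"
    by (intro nn_integral_mono ennreal_leI)
  also have "\<dots> \<le> ennreal (risk_const * \<tau>\<^sup>2)"
    using mean_bound by (simp add: mean_le_def risk_const_def)
  finally show ?thesis .
qed

end

section \<open>Large samples and the conclusion for every class\<close>

lemma eventually_sample_size:
  assumes "0 < \<epsilon>"
  shows "\<forall>\<^sub>F n in sequentially. 1 \<le> ln (real n) \<and> (ln (real n))\<^sup>2 \<le> exp (ln (real n) / 4) \<and> logrt n \<le> \<epsilon>"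
proof -
  have "filterlim (\<lambda>n. ln (real n)) at_top sequentially"
    by (rule filterlim_compose[OF ln_at_top filterlim_real_sequentially])
  \<comment> \<open>The threshold 1000 gives \<open>L\<^sup>2 \<le> L^4 / 10^6\<close>, while
    \<open>power4_le_exp\<close> yields \<open>L^4 \<le> 256 * 512 * exp (L / 4)\<close>, and 256 *
    512 < 10^6.\<close>
  then have "\<forall>\<^sub>F n in sequentially. 1000 \<le> ln (real n)" by (simp add: filterlim_at_top)
  moreover have "\<forall>\<^sub>F n in sequentially. logrt n < \<epsilon>"
  proof (rule order_tendstoD(2)[OF _ assms])
    show "logrt \<longlonglongrightarrow> 0"
      unfolding logrt_def[abs_def] using tendsto_real_sqrt[OF lim_ln_over_n] by simp
  qed
  ultimately show ?thesis
  proof eventually_elim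
    case (elim n)
    define L where "L = ln (real n)"
    have L: "1000 \<le> L" using elim by (simp add: L_def)
    have "(L / 4)^4 \<le> 256 * (exp (L / 4) + exp (- (L / 4)))" by (rule power4_le_exp)
    also have "\<dots> \<le> 256 * (exp (L / 4) + exp (L / 4))" using L by (intro mult_left_mono add_left_mono) auto
    finally have *: "(L / 4)^4 \<le> 512 * exp (L / 4)" by simp
    have "1000000 * L\<^sup>2 \<le> L\<^sup>2 * L\<^sup>2"
      using power_mono[OF L, of 2] by (intro mult_right_mono) auto
    moreover have "(L / 4)^4 = L\<^sup>2 * L\<^sup>2 / 256"
      by (simp add: power_divide power4_eq_xxxx power2_eq_square)
    ultimately have "L\<^sup>2 \<le> exp (L / 4)" using * exp_ge_zero[of "L / 4"] by linarith
    then show ?case using elim L by (simp add: L_def)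
  qed
qed

theorem theorem6:
  fixes \<Lambda> :: "'l::linorder set"
    and lmin lmax :: 'l
    and F :: "'l \<Rightarrow> (real \<Rightarrow> real) set"
    and D :: "(real \<Rightarrow> real) set"
    and T :: "(real \<Rightarrow> real) \<Rightarrow> real"
    and r :: "'l \<Rightarrow> real"
    and c1 c2 \<epsilon>0 :: real
  assumes classes: "\<And>a. a \<in> \<Lambda> \<Longrightarrow> F a \<subseteq> L2 \<and> closed_class (F a) \<and> convex_class (F a)"
    and functional: "linear_functional_on D T" "\<And>a. a \<in> \<Lambda> \<Longrightarrow> F a \<subseteq> D"
    and constants: "0 < c1" "c1 \<le> c2" "0 < \<epsilon>0"
    and C1: "lmin \<in> \<Lambda>" "lmax \<in> \<Lambda>" "\<And>a. a \<in> \<Lambda> \<Longrightarrow> lmin \<le> a \<and> a \<le> lmax"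
      "\<And>a b. a \<in> \<Lambda> \<Longrightarrow> b \<in> \<Lambda> \<Longrightarrow> a > b \<Longrightarrow> F a \<subseteq> F b"
    and C2: "\<And>\<epsilon> a. 0 < \<epsilon> \<Longrightarrow> \<epsilon> \<le> \<epsilon>0 \<Longrightarrow> a \<in> \<Lambda> \<Longrightarrow>
        ereal (c1 * \<epsilon> powr r a) \<le> modulus T \<epsilon> (F a) (F a) \<and>
        modulus T \<epsilon> (F a) (F a) \<le> ereal (c2 * \<epsilon> powr r a)"
      "\<And>a b. a \<in> \<Lambda> \<Longrightarrow> b \<in> \<Lambda> \<Longrightarrow> b < a \<Longrightarrow> 0 < r b \<and> r b < r a \<and> r a \<le> 1"
    and C3: "\<And>\<epsilon> a b. 0 < \<epsilon> \<Longrightarrow> \<epsilon> \<le> \<epsilon>0 \<Longrightarrow> a \<in> \<Lambda> \<Longrightarrow> b \<in> \<Lambda> \<Longrightarrow> b < a \<Longrightarrow>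
        modulus T \<epsilon> (F a) (F a) < modulus T \<epsilon> (F b) (F b) \<and>
        modulus_plus T \<epsilon> (F a) (F b) \<ge> ereal c1 * modulus T \<epsilon> (F b) (F b)"
    and C4: "\<And>\<epsilon>. 0 < \<epsilon> \<Longrightarrow> \<epsilon> \<le> \<epsilon>0 \<Longrightarrow> compact ((\<lambda>a. rmodulus T \<epsilon> (F a) (F a)) ` \<Lambda>)"
  shows "\<exists>C>0. \<forall>\<^sub>F n in sequentially.
    \<forall>(M :: 'w measure) W k \<xi> l S1 S.
      brownian_motion M W \<and> construction M W n T \<Lambda> F k \<xi> l S1 S \<longrightarrow>
      (let That = adaptive_estimator T n (\<lambda>i. F (l i)) k S1 S in
        sup_risk M T (F lmax) That
          \<le> ennreal (C * (rmodulus T (1 / sqrt (real n)) (F lmax) (F lmax))\<^sup>2) \<and>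
        (\<forall>a\<in>\<Lambda>. a < lmax \<longrightarrow>
          sup_risk M T (F a) That
            \<le> ennreal (C * (rmodulus T (logrt n) (F a) (F a))\<^sup>2)))"
proof -
  interpret nested_classes \<Lambda> lmin lmax F D T \<epsilon>0
  proof
    fix \<epsilon> :: real and a assume a: "0 < \<epsilon>" "\<epsilon> \<le> \<epsilon>0" "a \<in> \<Lambda>"
    have "0 < ereal (c1 * \<epsilon> powr r a)" using a constants by simp
    moreover have "ereal (c2 * \<epsilon> powr r a) < \<infinity>" by simp
    ultimately show "0 < modulus T \<epsilon> (F a) (F a) \<and> modulus T \<epsilon> (F a) (F a) < \<infinity>"
      using C2(1)[OF a] by (blast intro: order.strict_trans1 order.strict_trans2)
  qed (use classes functional constants C1 C3 in auto)
  show ?thesis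
  \<comment> \<open>The factor 4 is the square of the factor 2 lost when a class is replaced by its
    covering grid class.\<close>
  proof (intro exI[of _ "4 * risk_const"] conjI)
    show "0 < 4 * risk_const" using risk_const_pos by simp
    show "\<forall>\<^sub>F n in sequentially.
      \<forall>(M :: 'w measure) W k \<xi> l S1 S.
        brownian_motion M W \<and> construction M W n T \<Lambda> F k \<xi> l S1 S \<longrightarrow>
        (let That = adaptive_estimator T n (\<lambda>i. F (l i)) k S1 S in
          sup_risk M T (F lmax) That \<le> ennreal (4 * risk_const * (om (1 / sqrt (real n)) lmax)\<^sup>2) \<and>
          (\<forall>a\<in>\<Lambda>. a < lmax \<longrightarrow>
            sup_risk M T (F a) That \<le> ennreal (4 * risk_const * (om (logrt n) a)\<^sup>2)))"
      using eventually_sample_size[OF \<epsilon>0]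
    proof eventually_elim
      case (elim n)
      show ?case
        unfolding Let_def
      proof (intro allI impI conjI ballI; elim conjE)
        fix M :: "'w measure" and W k \<xi> l S1 S
        assume B: "brownian_motion M W" and con: "construction M W n T \<Lambda> F k \<xi> l S1 S"
        let ?That = "adaptive_estimator T n (\<lambda>i. F (l i)) k S1 S"
        have n1: "1 < n" using elim by (cases "n \<le> 1") (auto simp: le_Suc_eq)
        then have e: "0 < logrt n" "logrt n \<le> \<epsilon>0" using elim by (auto simp: logrt_def)
        have grid: "grid (om (logrt n) ` \<Lambda>) k \<xi>"
          and l: "\<And>j. 1 \<le> j \<Longrightarrow> j \<le> k \<Longrightarrow> l j \<in> \<Lambda>"
          and \<xi>: "\<And>j. 1 \<le> j \<Longrightarrow> j \<le> k \<Longrightarrow> \<xi> j = om (logrt n) (l j)"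
          using con unfolding construction_def by auto
        have Om: "Inf (om (logrt n) ` \<Lambda>) \<le> Sup (om (logrt n) ` \<Lambda>)"
          unfolding Omega_bounds[OF e] using extremes by (intro om_anti e) auto
        note g = grid_cases[OF grid Om]
        \<comment> \<open>By strictness only \<open>lmax\<close> attains the least modulus, so the
          first grid class is the smallest class and receives the rate without logarithm.\<close>
        have l1: "l 1 = lmax"
        proof (rule ccontr)
          assume "l 1 \<noteq> lmax"
          then have "om (logrt n) lmax < om (logrt n) (l 1)"
            using extremes l[of 1] g(1) by (intro om_strict e) (auto simp: less_le)
          then show False using g(1,2) \<xi>[of 1] Omega_bounds[OF e] by simp
        qed
        note risk = grid_risk[OF conjunct1[OF elim] conjunct1[OF conjunct2[OF elim]] e(2) B con]
        show "sup_risk M T (F lmax) ?That \<le> ennreal (4 * risk_const * (om (1 / sqrt (real n)) lmax)\<^sup>2)"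
          unfolding sup_risk_def
        proof (rule SUP_least)
          fix f assume "f \<in> F lmax"
          then have "(\<integral>\<^sup>+ w. ennreal ((?That f w - T f)\<^sup>2) \<partial>M)
              \<le> ennreal (risk_const * (om (1 / sqrt (real n)) lmax)\<^sup>2)"
            using risk[of 1 f, OF _ _ _ refl] g(1) l1 by simp
          also have "\<dots> \<le> ennreal (4 * risk_const * (om (1 / sqrt (real n)) lmax)\<^sup>2)"
            using risk_const_pos by (intro ennreal_leI mult_right_mono) auto
          finally show "(\<integral>\<^sup>+ w. ennreal ((?That f w - T f)\<^sup>2) \<partial>M)
              \<le> ennreal (4 * risk_const * (om (1 / sqrt (real n)) lmax)\<^sup>2)" .
        qed
        fix a assume a: "a \<in> \<Lambda>" "a < lmax"
        have "Inf (om (logrt n) ` \<Lambda>) < om (logrt n) a"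
          unfolding Omega_bounds[OF e] using a extremes by (intro om_strict e) auto
        moreover have "om (logrt n) a \<le> Sup (om (logrt n) ` \<Lambda>)"
          unfolding Omega_bounds[OF e] using a extremes by (intro om_anti e) auto
        \<comment> \<open>Below \<open>lmax\<close> the modulus lies strictly above the minimum, so
          the covering index is at least 2 and the rate at \<open>logrt n\<close> applies.\<close>
        ultimately obtain i where i: "2 \<le> i" "i \<le> k" "om (logrt n) a \<le> \<xi> i" "\<xi> i \<le> 2 * om (logrt n) a"
          using grid_covers[OF grid imageI[OF a(1)]] by blast
        have \<xi>i: "\<xi> i = om (logrt n) (l i)" using \<xi> i by simp
        have li: "l i \<in> \<Lambda>" using l i by simp
        have sub: "F a \<subseteq> F (l i)" using i(3) \<xi>i a li by (intro om_le_nested[OF e]) auto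
        show "sup_risk M T (F a) ?That \<le> ennreal (4 * risk_const * (om (logrt n) a)\<^sup>2)"
          unfolding sup_risk_def
        proof (rule SUP_least)
          fix f assume "f \<in> F a"
          then have "(\<integral>\<^sup>+ w. ennreal ((?That f w - T f)\<^sup>2) \<partial>M)
              \<le> ennreal (risk_const * (om (logrt n) (l i))\<^sup>2)"
            using risk[of i f, OF _ _ _ refl] i sub by auto
          also have "\<dots> \<le> ennreal (risk_const * (2 * om (logrt n) a)\<^sup>2)"
            using risk_const_pos i(4) \<xi>i om(2)[OF e li]
            by (intro ennreal_leI mult_left_mono power_mono) auto
          also have "risk_const * (2 * om (logrt n) a)\<^sup>2 = 4 * risk_const * (om (logrt n) a)\<^sup>2"
            by (simp add: power2_eq_square)
          finally show "(\<integral>\<^sup>+ w. ennreal ((?That f w - T f)\<^sup>2) \<partial>M)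
              \<le> ennreal (4 * risk_const * (om (logrt n) a)\<^sup>2)" .
        qed
      qed
    qed
  qed
qed

end
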